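(* Let $L$ be a positive number and set $E_1=\{(x,0)\in\mathbb{R}^2: 0\le x\le L\}$ and $E_2=\{(0,t)\in\mathbb{R}^2:0\le t\le L\}$. Then: (a) $\gamma_\Theta^{1/2}(E_1)>0$; (b) $\gamma_\Theta^{1/2}(E_2)=0$.
   Context: Here $N=1$; points of $\mathbb{R}^2$ are $(x,t)$ with $x,t\in\mathbb{R}$ (the second coordinate is time). $P(x,t)=\frac{t}{x^2+t^2}$ for $t>0$ and $P(x,t)=0$ for $t\le0$. For compact $E\subset\mathbb{R}^2$, $\gamma_\Theta^{1/2}(E)=\sup|\langle\nu,1\rangle|$, the supremum being over all distributions $\nu$ in $\mathbb{R}^2$ with $\operatorname{supp}\nu\subset E$ and $\|P*\nu\|_{L^\infty(\mathbb{R}^2)}\le1$. *)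

theory Defs
  imports "HOL-Analysis.Analysis"
begin

text \<open>Test functions and distributions are complex-valued, on a Euclidean space.\<close>

primrec iter_partial ::
  "'a::euclidean_space list \<Rightarrow> ('a \<Rightarrow> complex) \<Rightarrow> 'a \<Rightarrow> complex"
where
  "iter_partial [] f = f"
| "iter_partial (b # bs) f = (\<lambda>x. frechet_derivative (iter_partial bs f) (at x) b)"

text \<open>A function is of class \<open>C\<^sup>\<infinity>\<close> if all its iterated partial derivatives, in any order,
  exist and are differentiable (hence continuous).\<close>

definition smooth :: "('a::euclidean_space \<Rightarrow> complex) \<Rightarrow> bool" where
  "smooth f \<longleftrightarrow> (\<forall>bs x. set bs \<subseteq> Basis \<longrightarrow> iter_partial bs f differentiable at x)"

definition fun_support :: "('a::euclidean_space \<Rightarrow> complex) \<Rightarrow> 'a set" where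
  "fun_support f = closure {x. f x \<noteq> 0}"

definition test_function :: "('a::euclidean_space \<Rightarrow> complex) \<Rightarrow> bool" where
  "test_function \<phi> \<longleftrightarrow> smooth \<phi> \<and> compact (fun_support \<phi>)"

text \<open>The norm of \<open>C\<^sup>m\<close> on test functions.\<close>

definition Cm_norm :: "nat \<Rightarrow> ('a::euclidean_space \<Rightarrow> complex) \<Rightarrow> real" where
  "Cm_norm m \<phi> = (\<Sum>bs\<in>{bs. set bs \<subseteq> Basis \<and> length bs \<le> m}. SUP x. norm (iter_partial bs \<phi> x))"

text \<open>A distribution is represented by a total function on functions; only its values on test
  functions are meaningful. Continuity is expressed by the usual seminorm estimates.\<close>

definition distribution :: "(('a::euclidean_space \<Rightarrow> complex) \<Rightarrow> complex) \<Rightarrow> bool" where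
  "distribution u \<longleftrightarrow>
     (\<forall>\<phi> \<psi>. test_function \<phi> \<longrightarrow> test_function \<psi> \<longrightarrow> u (\<lambda>x. \<phi> x + \<psi> x) = u \<phi> + u \<psi>) \<and>
     (\<forall>c \<phi>. test_function \<phi> \<longrightarrow> u (\<lambda>x. c * \<phi> x) = c * u \<phi>) \<and>
     (\<forall>K. compact K \<longrightarrow>
        (\<exists>C m. \<forall>\<phi>. test_function \<phi> \<longrightarrow> fun_support \<phi> \<subseteq> K \<longrightarrow> norm (u \<phi>) \<le> C * Cm_norm m \<phi>))"

text \<open>The points having no open neighbourhood on which the distribution vanishes.\<close>

definition dist_support :: "(('a::euclidean_space \<Rightarrow> complex) \<Rightarrow> complex) \<Rightarrow> 'a set" where
  "dist_support u =
     {x. \<not> (\<exists>U. open U \<and> x \<in> U \<and>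
              (\<forall>\<phi>. test_function \<phi> \<longrightarrow> fun_support \<phi> \<subseteq> U \<longrightarrow> u \<phi> = 0))}"

definition cutoff :: "'a::euclidean_space set \<Rightarrow> ('a \<Rightarrow> complex) \<Rightarrow> bool" where
  "cutoff K \<eta> \<longleftrightarrow> test_function \<eta> \<and> (\<exists>U. open U \<and> K \<subseteq> U \<and> (\<forall>x\<in>U. \<eta> x = 1))"

text \<open>The pairing of a compactly supported distribution with a smooth function \<open>f\<close>, which need not
  have compact support: \<open>u (\<eta> f)\<close>, where \<open>\<eta>\<close> is a test function equal to 1 near the support
  of \<open>u\<close>. The value does not depend on the choice of \<open>\<eta>\<close>.\<close>

definition dist_pairing ::
  "(('a::euclidean_space \<Rightarrow> complex) \<Rightarrow> complex) \<Rightarrow> ('a \<Rightarrow> complex) \<Rightarrow> complex"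
where
  "dist_pairing u f = u (\<lambda>x. (SOME \<eta>. cutoff (dist_support u) \<eta>) x * f x)"

text \<open>The distribution given by a locally integrable function.\<close>

definition dist_of_fun ::
  "('a::euclidean_space \<Rightarrow> complex) \<Rightarrow> ('a \<Rightarrow> complex) \<Rightarrow> complex"
where
  "dist_of_fun f \<phi> = (LINT x|lborel. f x * \<phi> x)"

text \<open>Convolution of a distribution \<open>u\<close> with a compactly supported distribution \<open>v\<close>:
  \<open>v\<close> acts on \<open>y \<mapsto> \<phi> (x + y)\<close>, and \<open>u\<close> on the resulting test function of \<open>x\<close>.\<close>

definition dist_conv ::
  "(('a::euclidean_space \<Rightarrow> complex) \<Rightarrow> complex) \<Rightarrow> (('a \<Rightarrow> complex) \<Rightarrow> complex) \<Rightarrow>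
   ('a \<Rightarrow> complex) \<Rightarrow> complex"
where
  "dist_conv u v \<phi> = u (\<lambda>x. v (\<lambda>y. \<phi> (x + y)))"

text \<open>The distribution \<open>u\<close> is an \<open>L\<^sup>\<infinity>\<close> function of norm at most \<open>c\<close>.\<close>

definition Linf_norm_le :: "(('a::euclidean_space \<Rightarrow> complex) \<Rightarrow> complex) \<Rightarrow> real \<Rightarrow> bool" where
  "Linf_norm_le u c \<longleftrightarrow>
     (\<exists>f. f \<in> borel_measurable lborel \<and> (AE x in lborel. norm (f x) \<le> c) \<and>
          (\<forall>\<phi>. test_function \<phi> \<longrightarrow> u \<phi> = dist_of_fun f \<phi>))"

definition kernelP :: "real \<times> real \<Rightarrow> real" where
  "kernelP = (\<lambda>(x, t). if t > 0 then t / (x\<^sup>2 + t\<^sup>2) else 0)"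

definition admissible ::
  "(real \<times> real) set \<Rightarrow> ((real \<times> real \<Rightarrow> complex) \<Rightarrow> complex) \<Rightarrow> bool"
where
  "admissible E \<nu> \<longleftrightarrow>
     distribution \<nu> \<and> dist_support \<nu> \<subseteq> E \<and>
     Linf_norm_le (dist_conv (dist_of_fun (\<lambda>p. complex_of_real (kernelP p))) \<nu>) 1"

text \<open>The capacity \<open>\<gamma>\<^sub>\<Theta>\<^sup>1\<^sup>/\<^sup>2\<close> of a compact set \<open>E\<close>. The supremum is taken in
  \<open>[0, \<infinity>]\<close>, so that no finiteness is presupposed.\<close>

definition gamma_Theta_half :: "(real \<times> real) set \<Rightarrow> ennreal" where
  "gamma_Theta_half E = (SUP \<nu>\<in>{\<nu>. admissible E \<nu>}. ennreal (norm (dist_pairing \<nu> (\<lambda>_. 1))))"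

end

theory Submission
  imports Defs
begin

text \<open>
  A horizontal segment has positive capacity because the potential of its length measure is bounded:
  as a function of \<open>y\<close>, \<open>t / ((x - y)\<^sup>2 + t\<^sup>2)\<close> is the derivative of \<open>- arctan ((x - y) / t)\<close>, so its
  integral over any interval is at most \<open>\<pi>\<close> (\<open>kernelP_line_integral\<close>). Length divided by \<open>\<pi>\<close> is
  therefore admissible, and its total mass is \<open>L / \<pi>\<close> (\<open>gamma_horizontal_segment_pos\<close>).

  For a vertical segment the corresponding integral diverges: integrating \<open>t / (x\<^sup>2 + t\<^sup>2)\<close> over
  \<open>0 \<le> t \<le> 1\<close> gives \<open>- ln x + O(1)\<close> as \<open>x\<close> decreases to 0. Hence a nonzero constant density on the
  segment has an unbounded potential. A distribution \<open>\<nu>\<close> supported on the segment may in addition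
  contain derivatives of order \<open>k\<close> across the segment, but these contribute multiples of
  \<open>x\<close> to the power \<open>-k\<close>, and no combination of such powers with \<open>k \<ge> 1\<close> compensates a logarithm
  (\<open>log_dominated_by_polynomial\<close>).

  This becomes a proof by testing the potential against \<open>\<phi> (x, t) = g (z * x) * a t\<close> for large \<open>z\<close>,
  with \<open>g\<close> supported in \<open>{1..2}\<close> and \<open>a\<close> equal to 1 on a long interval. By definition the result is
  the integral of the kernel against \<open>u (x, t) = \<nu> (\<phi> ((x, t) + \<cdot>))\<close>. As \<open>\<nu>\<close> has finite order \<open>m\<close> near
  the segment, it annihilates products \<open>w x * a t\<close> in which \<open>w\<close> vanishes at 0 together with its
  derivatives up to order \<open>m\<close> (\<open>transversally_flat_annihilated\<close>). So Taylor expansion gives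
  \<open>u (x, t) = (\<Sum>k\<le>m. h\<^sub>k x * \<alpha>\<^sub>k t)\<close> with \<open>h\<^sub>k\<close> the derivative of order \<open>k\<close> of \<open>x \<mapsto> g (z * x)\<close>
  (\<open>transversal_expansion\<close>), where the \<open>\<alpha>\<^sub>k\<close> are constant on \<open>{0..1}\<close> and \<open>\<alpha>\<^sub>0 0\<close> is the total charge
  of \<open>\<nu>\<close>.

  The kernel is the real part of \<open>1 / (t + i x)\<close>, so integration by parts moves the derivatives from
  \<open>g\<close> to explicit powers (\<open>kernel_by_parts\<close>), whose integrals in \<open>t\<close> are \<open>- ln x\<close> for \<open>k = 0\<close> and
  \<open>(k - 1)! / x ^ k\<close> for \<open>k \<ge> 1\<close>, up to bounded errors (\<open>weighted_kernel_moment\<close>). Since \<open>\<phi>\<close> has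
  \<open>L\<^sup>1\<close> norm \<open>O(1 / z)\<close> and the potential is bounded, the charge times \<open>ln z\<close>, plus a polynomial in
  \<open>z\<close>, remains bounded as \<open>z\<close> grows. Hence the charge is 0.

  All test functions that have to be constructed are products of a function of \<open>x\<close> and a function of
  \<open>t\<close>. Smooth functions of one variable are handled through the sequence of their derivatives.
\<close>


section \<open>Smooth functions of one variable as sequences of derivatives\<close>

text \<open>A smooth function is carried together with all its derivatives: \<open>D n\<close> is the derivative of order
\<open>n\<close> of \<open>D 0\<close>. Bounds for derivatives can then be stated and combined without differentiating.\<close>

definition derivative_tower :: "(nat \<Rightarrow> real \<Rightarrow> real) \<Rightarrow> bool" where
  "derivative_tower D \<longleftrightarrow> (\<forall>n x. (D n has_real_derivative D (Suc n) x) (at x))"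

text \<open>Leibniz' rule.\<close>

definition tower_mult :: "(nat \<Rightarrow> real \<Rightarrow> real) \<Rightarrow> (nat \<Rightarrow> real \<Rightarrow> real) \<Rightarrow> nat \<Rightarrow> real \<Rightarrow> real" where
  "tower_mult D G n x = (\<Sum>k\<le>n. real (n choose k) * D k x * G (n - k) x)"

lemma tower_deriv: "derivative_tower D \<Longrightarrow> (D n has_real_derivative D (Suc n) x) (at x)"
  by (simp add: derivative_tower_def)

lemma tower_mult_0 [simp]: "tower_mult D G 0 x = D 0 x * G 0 x"
  by (simp add: tower_mult_def)

lemma tower_continuous_on: "derivative_tower D \<Longrightarrow> continuous_on S (D n)"
  by (meson DERIV_isCont continuous_at_imp_continuous_on tower_deriv)

lemma derivative_tower_mult:
  assumes "derivative_tower D" "derivative_tower G"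
  shows "derivative_tower (tower_mult D G)"
  unfolding derivative_tower_def
proof (intro allI)
  fix n x
  have "(tower_mult D G n has_real_derivative
      (\<Sum>k\<le>n. real (n choose k) * (D (Suc k) x * G (n - k) x + D k x * G (Suc (n - k)) x))) (at x)"
    unfolding tower_mult_def [abs_def]
    by (rule derivative_eq_intros tower_deriv assms refl)+ (simp add: algebra_simps)
  moreover have "(\<Sum>k\<le>n. real (n choose k) * (D (Suc k) x * G (n - k) x + D k x * G (Suc (n - k)) x))
      = tower_mult D G (Suc n) x"
  proof -
    let ?A = "\<lambda>k. real (n choose k) * (D (Suc k) x * G (n - k) x)"
    let ?B = "\<lambda>k. real (n choose k) * (D k x * G (Suc n - k) x)"
    have "tower_mult D G (Suc n) x =
        D 0 x * G (Suc n) x + (\<Sum>k\<le>n. real (Suc n choose Suc k) * D (Suc k) x * G (n - k) x)"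
      unfolding tower_mult_def by (subst sum.atMost_Suc_shift) simp
    also have "\<dots> = D 0 x * G (Suc n) x + (\<Sum>k\<le>n. real (n choose Suc k) * (D (Suc k) x * G (n - k) x)) + sum ?A {..n}"
      by (simp add: algebra_simps sum.distrib)
    also have "D 0 x * G (Suc n) x + (\<Sum>k\<le>n. real (n choose Suc k) * (D (Suc k) x * G (n - k) x))
        = sum ?B {..Suc n}"
      by (subst sum.atMost_Suc_shift) simp
    also have "sum ?B {..Suc n} = sum ?B {..n}" by simp
    also have "\<dots> = (\<Sum>k\<le>n. real (n choose k) * (D k x * G (Suc (n - k)) x))"
      by (intro sum.cong) (auto simp: Suc_diff_le)
    finally show ?thesis by (simp add: algebra_simps sum.distrib)
  qed
  ultimately show "(tower_mult D G n has_real_derivative tower_mult D G (Suc n) x) (at x)" by simp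
qed

lemma derivative_tower_affine:
  assumes "derivative_tower D"
  shows "derivative_tower (\<lambda>n x. r ^ n * D n (r * x + s))"
  unfolding derivative_tower_def
proof (intro allI)
  fix n x
  have "((\<lambda>x. D n (r * x + s)) has_real_derivative D (Suc n) (r * x + s) * r) (at x)"
    by (rule DERIV_chain2 [OF tower_deriv[OF assms]]) (auto intro!: derivative_eq_intros)
  from DERIV_cmult [OF this, of "r ^ n"]
  show "((\<lambda>x. r ^ n * D n (r * x + s)) has_real_derivative r ^ Suc n * D (Suc n) (r * x + s)) (at x)"
    by (simp add: algebra_simps)
qed

lemma derivative_tower_shift:
  assumes "derivative_tower D"
  shows "derivative_tower (\<lambda>n x. D n (s + x))"
  using derivative_tower_affine [OF assms, of 1 s] by (simp add: add.commute)

lemma derivative_tower_diff: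
  assumes "derivative_tower D" "derivative_tower G"
  shows "derivative_tower (\<lambda>n x. D n x - G n x)"
  using assms unfolding derivative_tower_def by (auto intro!: derivative_eq_intros)

lemma derivative_tower_sum:
  assumes "\<And>i. i \<in> I \<Longrightarrow> derivative_tower (D i)"
  shows "derivative_tower (\<lambda>n x. \<Sum>i\<in>I. c i * D i n x)"
  unfolding derivative_tower_def
  by (intro allI DERIV_sum DERIV_cmult tower_deriv assms)

text \<open>The normalised monomial \<open>x ^ k / k!\<close>, so that Taylor coefficients are plain derivatives.\<close>

definition power_tower :: "nat \<Rightarrow> nat \<Rightarrow> real \<Rightarrow> real" where
  "power_tower k n x = (if n \<le> k then x ^ (k - n) / fact (k - n) else 0)"

lemma derivative_tower_power: "derivative_tower (power_tower k)"
  unfolding derivative_tower_def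
proof (intro allI)
  fix n x
  show "(power_tower k n has_real_derivative power_tower k (Suc n) x) (at x)"
  proof (cases "n < k")
    case True
    then obtain j where j: "k - n = Suc j" "k - Suc n = j" by (metis Suc_diff_Suc)
    have "((\<lambda>x. x ^ Suc j / fact (Suc j)) has_real_derivative (real (Suc j) * x ^ j / fact (Suc j))) (at x)"
      using DERIV_cdivide [OF DERIV_pow [of "Suc j" x UNIV], of "fact (Suc j)"]
      by (simp del: fact_Suc power_Suc of_nat_Suc)
    moreover have "real (Suc j) * x ^ j / fact (Suc j) = x ^ j / fact j"
      by (simp add: fact_Suc del: of_nat_Suc)
    ultimately show ?thesis using True j unfolding power_tower_def [abs_def] by simp
  next
    case False
    then show ?thesis unfolding power_tower_def [abs_def] by (cases "n = k") auto
  qed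
qed

lemma tower_vanishes:
  assumes D: "derivative_tower D" and U: "open U" and 0: "\<And>x. x \<in> U \<Longrightarrow> D 0 x = 0" and "x \<in> U"
  shows "D n x = 0"
  using \<open>x \<in> U\<close>
proof (induction n arbitrary: x)
  case (Suc n)
  have "(D n has_real_derivative 0) (at x)"
    by (rule has_field_derivative_transform_within_open [where f = "\<lambda>_. 0" and S = U])
       (use Suc U in auto)
  then show ?case using DERIV_unique tower_deriv [OF D] by blast
qed (use 0 in auto)

lemma tower_bounded_on_compact:
  assumes D: "derivative_tower D"
  obtains B where "0 < B" "\<And>n x. \<lbrakk>n \<le> m; x \<in> {a..b}\<rbrakk> \<Longrightarrow> \<bar>D n x\<bar> \<le> B"
proof -
  have "\<exists>B. \<forall>x\<in>{a..b}. \<bar>D n x\<bar> \<le> B" for n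
  proof -
    have "compact (D n ` {a..b})"
      by (intro compact_continuous_image tower_continuous_on D compact_Icc)
    then have "bounded (D n ` {a..b})" by (rule compact_imp_bounded)
    then show ?thesis unfolding bounded_iff by (auto simp: image_iff)
  qed
  then obtain B where B: "\<And>n x. x \<in> {a..b} \<Longrightarrow> \<bar>D n x\<bar> \<le> B n" by metis
  show ?thesis
  proof
    show "0 < (\<Sum>n\<le>m. \<bar>B n\<bar>) + 1"
      by (simp add: add_nonneg_pos sum_nonneg)
    fix n x assume nx: "n \<le> m" "x \<in> {a..b}"
    have "\<bar>B n\<bar> \<le> (\<Sum>n\<le>m. \<bar>B n\<bar>)" using nx by (intro member_le_sum) auto
    then show "\<bar>D n x\<bar> \<le> (\<Sum>n\<le>m. \<bar>B n\<bar>) + 1" using B [OF nx(2), of n] by linarith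
  qed
qed

lemma tower_bounded:
  assumes D: "derivative_tower D" and 0: "\<And>x. x \<notin> {a..b} \<Longrightarrow> D 0 x = 0"
  obtains B where "0 < B" "\<And>n x. n \<le> m \<Longrightarrow> \<bar>D n x\<bar> \<le> B"
proof -
  obtain B where B: "0 < B" "\<And>n x. \<lbrakk>n \<le> m; x \<in> {a..b}\<rbrakk> \<Longrightarrow> \<bar>D n x\<bar> \<le> B"
    using tower_bounded_on_compact [OF D] by metis
  have "D n x = 0" if "x \<notin> {a..b}" for n x
    by (rule tower_vanishes [OF D, of "- {a..b}"]) (use that 0 in \<open>auto intro: open_Compl\<close>)
  with B show ?thesis by (intro that [of B]) (metis abs_zero less_imp_le)+
qed

lemma poly_exp_tendsto_0: "((\<lambda>z. poly p z * exp (- z)) \<longlongrightarrow> (0::real)) at_top"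
proof -
  have "((\<lambda>z. \<Sum>i\<le>degree p. coeff p i * (z ^ i / exp z)) \<longlongrightarrow> (\<Sum>i\<le>degree p. coeff p i * 0)) at_top"
    by (intro tendsto_intros tendsto_power_div_exp_0)
  then show ?thesis
    by (simp add: poly_altdef exp_minus divide_inverse sum_distrib_right mult.assoc)
qed

text \<open>The functions \<open>p (1 / x) * exp (- 1 / x)\<close> are closed under differentiation, also at 0, because the
exponential beats every polynomial. This yields the derivatives of \<open>exp (- 1 / x)\<close> all at once.\<close>

definition flat_exp :: "real poly \<Rightarrow> real \<Rightarrow> real" where
  "flat_exp p x = (if x > 0 then poly p (1 / x) * exp (- (1 / x)) else 0)"

lemma flat_exp_deriv:
  "(flat_exp p has_real_derivative flat_exp ([:0, 0, 1:] * (p - pderiv p)) x) (at x)"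
proof -
  consider "x > 0" | "x < 0" | "x = 0" by linarith
  then show ?thesis
  proof cases
    case 1
    have "((\<lambda>x. poly p (1 / x) * exp (- (1 / x))) has_real_derivative
        flat_exp ([:0, 0, 1:] * (p - pderiv p)) x) (at x)"
      using 1 unfolding flat_exp_def
      by (auto intro!: derivative_eq_intros DERIV_chain2 [OF poly_DERIV]
               simp: power2_eq_square field_simps)
    then show ?thesis
      by (rule has_field_derivative_transform_within_open [where S = "{0<..}"])
         (use 1 in \<open>auto simp: flat_exp_def\<close>)
  next
    case 2
    have "((\<lambda>x. 0) has_real_derivative flat_exp ([:0, 0, 1:] * (p - pderiv p)) x) (at x)"
      using 2 by (simp add: flat_exp_def)
    then show ?thesis
      by (rule has_field_derivative_transform_within_open [where S = "{..<0}"])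
         (use 2 in \<open>auto simp: flat_exp_def\<close>)
  next
    case 3
    have "((\<lambda>y. flat_exp p y / y) \<longlongrightarrow> 0) (at_right 0)"
    proof -
      have "((\<lambda>y. poly (pCons 0 p) (inverse y) * exp (- inverse y)) \<longlongrightarrow> 0) (at_right 0)"
        by (rule filterlim_compose [OF poly_exp_tendsto_0 filterlim_inverse_at_top_right])
      then show ?thesis
        by (rule Lim_transform_eventually)
           (auto simp: eventually_at_filter flat_exp_def field_simps)
    qed
    moreover have "((\<lambda>y. flat_exp p y / y) \<longlongrightarrow> 0) (at_left 0)"
      by (rule Lim_transform_eventually [OF tendsto_const])
         (auto simp: eventually_at_filter flat_exp_def)
    ultimately have "((\<lambda>y. flat_exp p y / y) \<longlongrightarrow> 0) (at 0)"
      by (simp add: filterlim_split_at)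
    then show ?thesis using 3 by (simp add: has_field_derivative_iff flat_exp_def)
  qed
qed

lemma flat_tower:
  "derivative_tower (\<lambda>n. flat_exp (((\<lambda>p. [:0, 0, 1:] * (p - pderiv p)) ^^ n) 1))"
  unfolding derivative_tower_def using flat_exp_deriv by simp

text \<open>The product \<open>h x * h (1 - x)\<close> with \<open>h x = exp (- 1 / x)\<close> for \<open>x > 0\<close> is a bump on \<open>{0..1}\<close>; its
normalised antiderivative is the step. Taking an antiderivative avoids dividing one tower by another.\<close>

lemma smooth_step:
  obtains S where "derivative_tower S" "\<And>x. 0 \<le> S 0 x" "\<And>x. S 0 x \<le> 1"
    "\<And>x. x \<le> 0 \<Longrightarrow> S 0 x = 0" "\<And>x. x \<ge> 1 \<Longrightarrow> S 0 x = 1"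
proof -
  define h where "h = (\<lambda>n. flat_exp (((\<lambda>p. [:0, 0, 1:] * (p - pderiv p)) ^^ n) 1))"
  have h: "derivative_tower h" unfolding h_def by (rule flat_tower)
  have h0: "h 0 x = (if x > 0 then exp (- (1 / x)) else 0)" for x
    by (simp add: h_def flat_exp_def)
  define f where "f = tower_mult h (\<lambda>n x. (- 1) ^ n * h n ((- 1) * x + 1))"
  have f: "derivative_tower f"
    unfolding f_def by (intro derivative_tower_mult h derivative_tower_affine)
  have f0: "f 0 x = h 0 x * h 0 (1 - x)" for x by (simp add: f_def)
  have f_nonneg: "f 0 x \<ge> 0" for x by (simp add: f0 h0)
  have "\<exists>F. \<forall>x::real. -\<infinity> < ereal x \<longrightarrow> ereal x < \<infinity> \<longrightarrow> (F has_vector_derivative f 0 x) (at x)"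
    by (rule einterval_antiderivative)
       (use tower_continuous_on [OF f, of UNIV 0] in \<open>auto simp: continuous_on_eq_continuous_at\<close>)
  then obtain F where F: "\<And>x. (F has_real_derivative f 0 x) (at x)"
    by (auto simp: has_real_derivative_iff_has_vector_derivative)
  have mono: "F x \<le> F y" if "x \<le> y" for x y
    by (rule DERIV_nonneg_imp_nondecreasing [OF that]) (use F f_nonneg in blast)
  have le0: "F x = F 0" if "x \<le> 0" for x
  proof -
    have "F 0 \<le> F x"
      by (rule DERIV_nonpos_imp_nonincreasing [OF that])
         (metis F f0 h0 mult_eq_0_iff not_less order_refl)
    then show ?thesis using mono [OF that] by simp
  qed
  have ge1: "F x = F 1" if "x \<ge> 1" for x
  proof -
    have "F x \<le> F 1"
    proof (rule DERIV_nonpos_imp_nonincreasing [OF that])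
      fix y :: real assume "1 \<le> y" "y \<le> x"
      then have "f 0 y = 0" by (simp add: f0 h0)
      then show "\<exists>d. (F has_real_derivative d) (at y) \<and> d \<le> 0" using F [of y] by auto
    qed
    then show ?thesis using mono [OF that] by simp
  qed
  have lt: "F 0 < F 1"
  proof (rule DERIV_pos_imp_increasing_open [of 0 1 F])
    fix x :: real assume "0 < x" "x < 1"
    then have "f 0 x > 0" by (simp add: f0 h0)
    then show "\<exists>d. (F has_real_derivative d) (at x) \<and> 0 < d" using F by blast
  next
    show "continuous_on {0..1} F"
      by (meson F DERIV_isCont continuous_at_imp_continuous_on)
  qed auto
  define S where "S = (\<lambda>n x. case n of 0 \<Rightarrow> (F x - F 0) / (F 1 - F 0) | Suc k \<Rightarrow> f k x / (F 1 - F 0))"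
  show ?thesis
  proof
    show "derivative_tower S" unfolding derivative_tower_def
    proof (intro allI)
      fix n x
      have "((\<lambda>x. (F x - F 0) / (F 1 - F 0)) has_real_derivative f 0 x / (F 1 - F 0)) (at x)"
        using lt by (auto intro!: derivative_eq_intros F)
      moreover have "((\<lambda>x. f k x / (F 1 - F 0)) has_real_derivative f (Suc k) x / (F 1 - F 0)) (at x)" for k
        using lt by (auto intro!: derivative_eq_intros tower_deriv [OF f])
      ultimately show "(S n has_real_derivative S (Suc n) x) (at x)"
        by (cases n) (simp_all add: S_def)
    qed
    show "0 \<le> S 0 x" for x using mono [of 0 x] le0 [of x] lt by (cases "x \<le> 0") (auto simp: S_def)
    show "S 0 x \<le> 1" for x using mono [of x 1] ge1 [of x] lt by (cases "x \<le> 1") (auto simp: S_def)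
    show "S 0 x = 0" if "x \<le> 0" for x using le0 [OF that] by (simp add: S_def)
    show "S 0 x = 1" if "x \<ge> 1" for x using ge1 [OF that] lt by (simp add: S_def)
  qed
qed

text \<open>Product of a rising and a falling step of width \<open>\<delta>\<close>.\<close>

lemma smooth_plateau:
  fixes a b \<delta> :: real
  assumes "\<delta> > 0"
  obtains D where "derivative_tower D" "\<And>x. 0 \<le> D 0 x" "\<And>x. D 0 x \<le> 1"
    "\<And>x. x \<in> {a - \<delta>..b + \<delta>} \<Longrightarrow> D 0 x = 1" "\<And>x. x \<notin> {a - 2 * \<delta>..b + 2 * \<delta>} \<Longrightarrow> D 0 x = 0"
proof -
  obtain S where S: "derivative_tower S" "\<And>x. 0 \<le> S 0 x" "\<And>x. S 0 x \<le> 1"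
    "\<And>x. x \<le> 0 \<Longrightarrow> S 0 x = 0" "\<And>x. x \<ge> 1 \<Longrightarrow> S 0 x = 1"
    using smooth_step by metis
  define D where "D = tower_mult (\<lambda>n x. (1 / \<delta>) ^ n * S n (1 / \<delta> * x + (2 - a / \<delta>)))
     (\<lambda>n x. (- (1 / \<delta>)) ^ n * S n (- (1 / \<delta>) * x + (2 + b / \<delta>)))"
  have "1 / \<delta> * x + (2 - a / \<delta>) = (x - a + 2 * \<delta>) / \<delta>"
    "- (1 / \<delta>) * x + (2 + b / \<delta>) = (b - x + 2 * \<delta>) / \<delta>" for x
    using assms by (simp_all add: field_simps)
  then have D0: "D 0 x = S 0 ((x - a + 2 * \<delta>) / \<delta>) * S 0 ((b - x + 2 * \<delta>) / \<delta>)" for x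
    by (simp add: D_def)
  show ?thesis
  proof
    show "derivative_tower D"
      unfolding D_def by (intro derivative_tower_mult derivative_tower_affine S(1))
    show "0 \<le> D 0 x" for x by (simp add: D0 S)
    show "D 0 x \<le> 1" for x unfolding D0 by (intro mult_le_one S)
    show "D 0 x = 1" if "x \<in> {a - \<delta>..b + \<delta>}" for x
    proof -
      have "(x - a + 2 * \<delta>) / \<delta> \<ge> 1" "(b - x + 2 * \<delta>) / \<delta> \<ge> 1"
        using that assms by (simp_all add: le_divide_eq)
      then show ?thesis by (simp add: D0 S)
    qed
    show "D 0 x = 0" if "x \<notin> {a - 2 * \<delta>..b + 2 * \<delta>}" for x
    proof -
      have "(x - a + 2 * \<delta>) / \<delta> \<le> 0 \<or> (b - x + 2 * \<delta>) / \<delta> \<le> 0"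
        using that assms by (auto simp: divide_le_0_iff)
      then show ?thesis unfolding D0 using S(4) by auto
    qed
  qed
qed

section \<open>Smooth functions and distributions in the plane\<close>

text \<open>Indexes the terms of the general Leibniz rule: the ways of distributing a list of differentiations
over the two factors of a product.\<close>

fun splits :: "'b list \<Rightarrow> ('b list \<times> 'b list) list" where
  "splits [] = [([], [])]"
| "splits (b # bs) = map (\<lambda>(u, v). (b # u, v)) (splits bs) @ map (\<lambda>(u, v). (u, b # v)) (splits bs)"

lemma set_splits: "(u, v) \<in> set (splits bs) \<Longrightarrow> set u \<subseteq> set bs \<and> set v \<subseteq> set bs"
  by (induction bs arbitrary: u v) fastforce+

lemma smooth_differentiable:
  "smooth f \<Longrightarrow> set bs \<subseteq> Basis \<Longrightarrow> iter_partial bs f differentiable at x"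
  by (simp add: smooth_def)

lemma smooth_continuous_on: "smooth f \<Longrightarrow> continuous_on S f"
  using smooth_differentiable [of f "[]"]
  by (auto intro!: continuous_at_imp_continuous_on differentiable_imp_continuous_within)

lemma iter_partial_mult:
  assumes "smooth f" "smooth g" "set bs \<subseteq> Basis"
  shows "iter_partial bs (\<lambda>x. f x * g x) =
    (\<lambda>x. \<Sum>(u, v)\<leftarrow>splits bs. iter_partial u f x * iter_partial v g x)"
  using assms(3)
proof (induction bs)
  case (Cons b bs)
  have dv: "iter_partial u f differentiable at x" "iter_partial v g differentiable at x"
    if "(u, v) \<in> set (splits bs)" for u v x
    using set_splits [OF that] Cons.prems smooth_differentiable assms(1,2)
    by (metis order_trans set_subset_Cons)+
  have "((\<lambda>x. \<Sum>(u, v)\<leftarrow>L. iter_partial u f x * iter_partial v g x) has_derivative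
      (\<lambda>h. \<Sum>(u, v)\<leftarrow>L. iter_partial u f x * frechet_derivative (iter_partial v g) (at x) h
             + frechet_derivative (iter_partial u f) (at x) h * iter_partial v g x)) (at x)"
    if "set L \<subseteq> set (splits bs)" for L x
    using that
  proof (induction L)
    case (Cons p L)
    obtain u v where p: "p = (u, v)" by force
    have "((\<lambda>x. iter_partial u f x * iter_partial v g x) has_derivative
      (\<lambda>h. iter_partial u f x * frechet_derivative (iter_partial v g) (at x) h
             + frechet_derivative (iter_partial u f) (at x) h * iter_partial v g x)) (at x)"
      using Cons.prems p dv [of u v x] by (intro has_derivative_mult frechet_derivative_works [THEN iffD1]) auto
    moreover have "set L \<subseteq> set (splits bs)" using Cons.prems by simp
    ultimately show ?case
      using has_derivative_add Cons.IH p by fastforce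
  qed simp
  note d = frechet_derivative_at [OF this [OF order_refl], symmetric, unfolded case_prod_beta']
  from Cons show ?case
    by (simp add: d case_prod_beta' sum_list_addf comp_def add.commute)
qed simp

lemma smooth_mult:
  assumes "smooth f" "smooth g"
  shows "smooth (\<lambda>x. f x * g x)"
  unfolding smooth_def
proof (intro allI impI)
  fix bs :: "'a list" and x assume bs: "set bs \<subseteq> Basis"
  have "(\<lambda>x. \<Sum>(u, v)\<leftarrow>L. iter_partial u f x * iter_partial v g x) differentiable at x"
    if "set L \<subseteq> set (splits bs)" for L
    using that
  proof (induction L)
    case (Cons p L)
    obtain u v where p: "p = (u, v)" by force
    then have "set u \<subseteq> Basis" "set v \<subseteq> Basis" using set_splits [of u v bs] Cons.prems bs by auto
    then have "(\<lambda>x. iter_partial u f x * iter_partial v g x) differentiable at x"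
      by (intro differentiable_mult smooth_differentiable assms)
    then show ?case using Cons p by (auto intro!: differentiable_add)
  qed simp
  then show "iter_partial bs (\<lambda>x. f x * g x) differentiable at x"
    by (simp add: iter_partial_mult [OF assms bs])
qed

lemma iter_partial_add:
  assumes "smooth f" "smooth g" "set bs \<subseteq> Basis"
  shows "iter_partial bs (\<lambda>x. f x + g x) = (\<lambda>x. iter_partial bs f x + iter_partial bs g x)"
  using assms(3)
proof (induction bs)
  case (Cons b bs)
  have "((\<lambda>x. iter_partial bs f x + iter_partial bs g x) has_derivative
      (\<lambda>h. frechet_derivative (iter_partial bs f) (at x) h + frechet_derivative (iter_partial bs g) (at x) h)) (at x)" for x
    using smooth_differentiable [OF assms(1), of bs] smooth_differentiable [OF assms(2), of bs] Cons.prems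
    by (intro has_derivative_add frechet_derivative_works [THEN iffD1]) auto
  note d = frechet_derivative_at [OF this, symmetric]
  from Cons show ?case by (simp add: d)
qed simp

lemma iter_partial_cmult:
  assumes "smooth f" "set bs \<subseteq> Basis"
  shows "iter_partial bs (\<lambda>x. c * f x) = (\<lambda>x. c * iter_partial bs f x)"
  using assms(2)
proof (induction bs)
  case (Cons b bs)
  have "((\<lambda>x. c * iter_partial bs f x) has_derivative
      (\<lambda>h. c * frechet_derivative (iter_partial bs f) (at x) h)) (at x)" for x
    using smooth_differentiable [OF assms(1), of bs] Cons.prems
    by (intro has_derivative_mult_right frechet_derivative_works [THEN iffD1]) auto
  note d = frechet_derivative_at [OF this, symmetric]
  from Cons show ?case by (simp add: d)
qed simp

lemma smooth_add: "smooth f \<Longrightarrow> smooth g \<Longrightarrow> smooth (\<lambda>x. f x + g x)"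
  by (simp add: smooth_def [of "\<lambda>x. f x + g x"] iter_partial_add smooth_differentiable)

lemma smooth_cmult: "smooth f \<Longrightarrow> smooth (\<lambda>x. c * f x)"
  by (simp add: smooth_def [of "\<lambda>x. c * f x"] iter_partial_cmult smooth_differentiable differentiable_mult)

lemma smooth_const: "smooth (\<lambda>_. c)"
proof -
  have "iter_partial bs (\<lambda>_. c) = (\<lambda>_. if bs = [] then c else 0)" for bs :: "'a list"
  proof (induction bs)
    case (Cons b bs)
    then show ?case by (cases bs) (simp_all add: fun_eq_iff)
  qed simp
  then show ?thesis by (simp add: smooth_def)
qed

lemma fun_support_subset: "closed S \<Longrightarrow> (\<And>x. x \<notin> S \<Longrightarrow> f x = 0) \<Longrightarrow> fun_support f \<subseteq> S"
  unfolding fun_support_def by (rule closure_minimal) auto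

lemma fun_support_outside: "x \<notin> fun_support f \<Longrightarrow> f x = 0"
  unfolding fun_support_def using closure_subset [of "{x. f x \<noteq> 0}"] by auto

lemma closed_fun_support [simp]: "closed (fun_support f)"
  by (simp add: fun_support_def)

lemma test_functionI:
  assumes "smooth \<phi>" "compact K" "\<And>x. x \<notin> K \<Longrightarrow> \<phi> x = 0"
  shows "test_function \<phi>"
proof -
  have "fun_support \<phi> \<subseteq> K"
    by (rule fun_support_subset [OF compact_imp_closed [OF assms(2)] assms(3)])
  then have "compact (fun_support \<phi>)"
    using compact_Int_closed [OF assms(2) closed_fun_support [of \<phi>]] by (simp add: Int_absorb1)
  then show ?thesis using assms(1) by (simp add: test_function_def)
qed

lemma test_function_add:
  assumes "test_function \<phi>" "test_function \<psi>"
  shows "test_function (\<lambda>x. \<phi> x + \<psi> x)"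
  by (rule test_functionI [of _ "fun_support \<phi> \<union> fun_support \<psi>"])
     (use assms in \<open>auto simp: test_function_def smooth_add fun_support_outside compact_Un\<close>)

lemma test_function_cmult: "test_function \<phi> \<Longrightarrow> test_function (\<lambda>x. c * \<phi> x)"
  by (rule test_functionI [of _ "fun_support \<phi>"])
     (auto simp: test_function_def smooth_cmult fun_support_outside)

lemma test_function_mult: "test_function \<phi> \<Longrightarrow> smooth \<psi> \<Longrightarrow> test_function (\<lambda>x. \<phi> x * \<psi> x)"
  by (rule test_functionI [of _ "fun_support \<phi>"])
     (auto simp: test_function_def smooth_mult fun_support_outside)

lemma test_function_diff:
  assumes "test_function \<phi>" "test_function \<psi>"
  shows "test_function (\<lambda>x. \<phi> x - \<psi> x)"
  using test_function_add [OF assms(1) test_function_cmult [OF assms(2), of "- 1"]] by simp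

lemma distribution_add:
  "\<lbrakk>distribution u; test_function \<phi>; test_function \<psi>\<rbrakk> \<Longrightarrow> u (\<lambda>x. \<phi> x + \<psi> x) = u \<phi> + u \<psi>"
  by (simp add: distribution_def)

lemma distribution_cmult:
  "\<lbrakk>distribution u; test_function \<phi>\<rbrakk> \<Longrightarrow> u (\<lambda>x. c * \<phi> x) = c * u \<phi>"
  by (simp add: distribution_def)

lemma distribution_diff:
  assumes "distribution u" "test_function \<phi>" "test_function \<psi>"
  shows "u (\<lambda>x. \<phi> x - \<psi> x) = u \<phi> - u \<psi>"
  using distribution_add [OF assms(1,2) test_function_cmult [OF assms(3), of "- 1"]]
    distribution_cmult [OF assms(1,3), of "- 1"] by simp

lemma distribution_zero: "distribution u \<Longrightarrow> u (\<lambda>_. 0) = 0"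
  using distribution_cmult [of u "\<lambda>_. 0" 0] test_functionI [OF smooth_const, of "{}"] by simp

text \<open>The iterated partial derivatives of these products only depend on how often each variable occurs
(\<open>iter_partial_tensor\<close>), so smoothness and \<open>C\<^sup>m\<close> norms reduce to one variable.\<close>

definition tensor :: "(nat \<Rightarrow> real \<Rightarrow> real) \<Rightarrow> (nat \<Rightarrow> real \<Rightarrow> real) \<Rightarrow> real \<times> real \<Rightarrow> complex" where
  "tensor D G p = complex_of_real (D 0 (fst p) * G 0 (snd p))"

lemma tensor_has_derivative:
  assumes "derivative_tower D" "derivative_tower G"
  shows "((\<lambda>p. complex_of_real (D i (fst p) * G j (snd p))) has_derivative
    (\<lambda>h. complex_of_real (D (Suc i) (fst p) * G j (snd p) * fst h + D i (fst p) * G (Suc j) (snd p) * snd h)))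
    (at p)"
proof -
  have 1: "((\<lambda>p. D i (fst p)) has_derivative (\<lambda>h. D (Suc i) (fst p) * fst h)) (at p)"
    using has_derivative_compose [OF has_derivative_fst [OF has_derivative_ident]
       tower_deriv [OF assms(1), of i "fst p", THEN has_field_derivative_imp_has_derivative]] by simp
  have 2: "((\<lambda>p. G j (snd p)) has_derivative (\<lambda>h. G (Suc j) (snd p) * snd h)) (at p)"
    using has_derivative_compose [OF has_derivative_snd [OF has_derivative_ident]
       tower_deriv [OF assms(2), of j "snd p", THEN has_field_derivative_imp_has_derivative]] by simp
  from has_derivative_of_real [OF has_derivative_mult [OF 1 2]]
  show ?thesis by (rule has_derivative_eq_rhs) (simp add: fun_eq_iff algebra_simps)
qed

lemma Basis_plane: "Basis = {(1, 0), (0, 1) :: real \<times> real}"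
  by (auto simp: Basis_prod_def)

lemma iter_partial_tensor:
  assumes "derivative_tower D" "derivative_tower G" "set bs \<subseteq> Basis"
  shows "iter_partial bs (tensor D G) =
    (\<lambda>p. complex_of_real (D (count_list bs (1, 0)) (fst p) * G (count_list bs (0, 1)) (snd p)))"
  using assms(3)
proof (induction bs)
  case Nil
  then show ?case by (simp add: tensor_def fun_eq_iff)
next
  case (Cons b bs)
  then consider "b = (1, 0)" | "b = (0, 1)" by (auto simp: Basis_plane)
  then show ?case
    using Cons tensor_has_derivative [OF assms(1,2), THEN frechet_derivative_at, symmetric]
    by cases simp_all
qed

lemma smooth_tensor: "derivative_tower D \<Longrightarrow> derivative_tower G \<Longrightarrow> smooth (tensor D G)"
  unfolding smooth_def using differentiableI [OF tensor_has_derivative] by (simp add: iter_partial_tensor)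

lemma tensor_outside:
  assumes "\<And>x. x \<notin> A \<Longrightarrow> D 0 x = 0" "\<And>x. x \<notin> B \<Longrightarrow> G 0 x = 0" "p \<notin> A \<times> B"
  shows "tensor D G p = 0"
  using assms(1) [of "fst p"] assms(2) [of "snd p"] assms(3) by (auto simp: tensor_def mem_Times_iff)

lemma test_function_tensor:
  assumes "derivative_tower D" "derivative_tower G"
    "\<And>x. x \<notin> {a..b} \<Longrightarrow> D 0 x = 0" "\<And>x. x \<notin> {c..d} \<Longrightarrow> G 0 x = 0"
  shows "test_function (tensor D G)"
proof (rule test_functionI)
  show "smooth (tensor D G)" by (rule smooth_tensor [OF assms(1,2)])
  show "compact ({a..b} \<times> {c..d})" by (intro compact_Times compact_Icc)
  show "tensor D G p = 0" if "p \<notin> {a..b} \<times> {c..d}" for p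
    by (rule tensor_outside [where A = "{a..b}" and B = "{c..d}"]) (fact assms that)+
qed

lemma Cm_norm_tensor_le:
  assumes "derivative_tower D" "derivative_tower G"
    and D: "\<And>i x. i \<le> m \<Longrightarrow> \<bar>D i x\<bar> \<le> A" and G: "\<And>i x. i \<le> m \<Longrightarrow> \<bar>G i x\<bar> \<le> B"
  shows "\<bar>Cm_norm m (tensor D G)\<bar> \<le>
    real (card {bs. set bs \<subseteq> (Basis :: (real \<times> real) set) \<and> length bs \<le> m}) * (A * B)"
proof -
  have "\<bar>SUP x. cmod (iter_partial bs (tensor D G) x)\<bar> \<le> A * B"
    if bs: "set bs \<subseteq> (Basis :: (real \<times> real) set)" "length bs \<le> m" for bs
  proof (rule cSup_abs_le)
    fix y assume "y \<in> range (\<lambda>x. cmod (iter_partial bs (tensor D G) x))"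
    then obtain x where x: "y = cmod (iter_partial bs (tensor D G) x)" by blast
    have "count_list bs b \<le> m" for b using count_le_length [of bs b] bs(2) by simp
    then show "\<bar>y\<bar> \<le> A * B"
      unfolding x iter_partial_tensor [OF assms(1,2) bs(1)] norm_of_real abs_mult abs_idempotent
      using D [of 0 0] by (intro mult_mono D G) auto
  qed simp
  then show ?thesis unfolding Cm_norm_def
    by (intro order_trans [OF sum_abs] sum_bounded_above) auto
qed

lemma plateau_near_point:
  fixes p :: "real \<times> real"
  assumes "open U" "p \<in> U"
  obtains \<theta> V where "test_function \<theta>" "open V" "p \<in> V" "\<And>x. x \<in> V \<Longrightarrow> \<theta> x = 1"
    "fun_support \<theta> \<subseteq> U"
proof -
  obtain A B where AB: "open A" "open B" "p \<in> A \<times> B" "A \<times> B \<subseteq> U"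
    using open_prod_elim [OF assms] by metis
  obtain a where a: "a > 0" "cball (fst p) a \<subseteq> A" using AB open_contains_cball by (metis mem_Times_iff)
  obtain b where b: "b > 0" "cball (snd p) b \<subseteq> B" using AB open_contains_cball by (metis mem_Times_iff)
  obtain D where D: "derivative_tower D" "\<And>x. x \<in> {fst p - a/2..fst p + a/2} \<Longrightarrow> D 0 x = 1"
    "\<And>x. x \<notin> {fst p - 2 * (a/2)..fst p + 2 * (a/2)} \<Longrightarrow> D 0 x = 0"
    using smooth_plateau [of "a/2" "fst p" "fst p"] a(1) by (metis half_gt_zero)
  obtain G where G: "derivative_tower G" "\<And>x. x \<in> {snd p - b/2..snd p + b/2} \<Longrightarrow> G 0 x = 1"
    "\<And>x. x \<notin> {snd p - 2 * (b/2)..snd p + 2 * (b/2)} \<Longrightarrow> G 0 x = 0"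
    using smooth_plateau [of "b/2" "snd p" "snd p"] b(1) by (metis half_gt_zero)
  let ?V = "{fst p - a/2<..<fst p + a/2} \<times> {snd p - b/2<..<snd p + b/2}"
  let ?K = "{fst p - a..fst p + a} \<times> {snd p - b..snd p + b}"
  show ?thesis
  proof
    show "test_function (tensor D G)"
      by (rule test_function_tensor [OF D(1) G(1) D(3) G(3)])
    show "open ?V" by (intro open_Times open_greaterThanLessThan)
    show "p \<in> ?V" using a b by (auto simp: mem_Times_iff)
    show "tensor D G x = 1" if "x \<in> ?V" for x
      using that by (auto simp: tensor_def D G mem_Times_iff)
    have "fun_support (tensor D G) \<subseteq> ?K"
    proof (rule fun_support_subset)
      show "closed ?K" by (intro closed_Times closed_atLeastAtMost)
      show "tensor D G x = 0" if "x \<notin> ?K" for x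
        by (rule tensor_outside [where A = "{fst p - 2 * (a/2)..fst p + 2 * (a/2)}"
              and B = "{snd p - 2 * (b/2)..snd p + 2 * (b/2)}"])
           (fact D(3), fact G(3), use that in simp)
    qed
    also have "?K \<subseteq> A \<times> B"
      using a(2) b(2) by (intro Sigma_mono) (auto simp: cball_eq_atLeastAtMost)
    also note AB(4)
    finally show "fun_support (tensor D G) \<subseteq> U" .
  qed
qed

text \<open>The support is defined pointwise, so this needs finitely many plateau functions covering the
compact support of \<open>\<phi>\<close>. Multiplying \<open>\<phi>\<close> by the factors \<open>1 - \<theta>\<close> one by one plays the role of a
partition of unity and stays within products of smooth functions.\<close>

lemma distribution_vanishes_off_support:
  fixes \<nu> :: "(real \<times> real \<Rightarrow> complex) \<Rightarrow> complex"
  assumes \<nu>: "distribution \<nu>" and \<phi>: "test_function \<phi>"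
    and disj: "fun_support \<phi> \<inter> dist_support \<nu> = {}"
  shows "\<nu> \<phi> = 0"
proof -
  define good where "good = (\<lambda>V. open V \<and> (\<exists>\<theta>. smooth \<theta> \<and> (\<forall>x\<in>V. \<theta> x = 1) \<and>
      (\<forall>\<psi>. test_function \<psi> \<longrightarrow> \<nu> (\<lambda>x. \<psi> x * \<theta> x) = 0)))"
  have "\<exists>V. good V \<and> p \<in> V" if "p \<in> fun_support \<phi>" for p
  proof -
    have "p \<notin> dist_support \<nu>" using that disj by blast
    then obtain U where U: "open U" "p \<in> U"
      and "\<forall>\<psi>. test_function \<psi> \<longrightarrow> fun_support \<psi> \<subseteq> U \<longrightarrow> \<nu> \<psi> = 0"
      unfolding dist_support_def mem_Collect_eq not_not by metis
    then have \<nu>_U: "\<nu> \<psi> = 0" if "test_function \<psi>" "fun_support \<psi> \<subseteq> U" for \<psi>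
      using that by simp
    obtain \<theta> V where \<theta>: "test_function \<theta>" "open V" "p \<in> V" "\<And>x. x \<in> V \<Longrightarrow> \<theta> x = 1"
      "fun_support \<theta> \<subseteq> U"
      using plateau_near_point [OF U(1,2)] by metis
    have smooth: "smooth \<theta>" using \<theta>(1) by (simp add: test_function_def)
    have "\<nu> (\<lambda>x. \<psi> x * \<theta> x) = 0" if "test_function \<psi>" for \<psi>
    proof (rule \<nu>_U)
      show "test_function (\<lambda>x. \<psi> x * \<theta> x)" by (rule test_function_mult [OF that smooth])
      have "fun_support (\<lambda>x. \<psi> x * \<theta> x) \<subseteq> fun_support \<theta>"
        by (rule fun_support_subset) (simp_all add: fun_support_outside)
      then show "fun_support (\<lambda>x. \<psi> x * \<theta> x) \<subseteq> U" using \<theta>(5) by (rule order_trans)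
    qed
    then have "good V" unfolding good_def using \<theta>(2,4) smooth by (intro conjI exI [of _ \<theta>]) simp_all
    with \<theta>(3) show ?thesis by blast
  qed
  then have "\<And>p. p \<in> fun_support \<phi> \<Longrightarrow> \<exists>V\<in>Collect good. p \<in> V" by blast
  moreover have "\<And>V. V \<in> Collect good \<Longrightarrow> open V" by (simp add: good_def)
  moreover have "compact (fun_support \<phi>)" using \<phi> by (simp add: test_function_def)
  ultimately obtain \<V> where \<V>: "\<V> \<subseteq> Collect good" "finite \<V>" "fun_support \<phi> \<subseteq> \<Union> \<V>"
    using compactE [of "fun_support \<phi>" "Collect good"] by (metis UnionI subsetI)
  \<comment> \<open>Multiplying by \<open>1 - \<theta>\<close> for one set of the cover after another leaves the value of \<open>\<nu>\<close>
    unchanged and removes that set from the support.\<close>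
  have "\<exists>\<psi>. test_function \<psi> \<and> \<nu> \<psi> = \<nu> \<phi> \<and> (\<forall>x. x \<notin> fun_support \<phi> - \<Union> \<V> \<longrightarrow> \<psi> x = 0)"
    using \<V>(2,1)
  proof (induction \<V>)
    case empty
    then show ?case using \<phi> fun_support_outside by auto
  next
    case (insert V \<V>)
    then obtain \<psi> where \<psi>: "test_function \<psi>" "\<nu> \<psi> = \<nu> \<phi>" "\<And>x. x \<notin> fun_support \<phi> - \<Union> \<V> \<Longrightarrow> \<psi> x = 0"
      by auto
    obtain \<theta> where \<theta>: "smooth \<theta>" "\<And>x. x \<in> V \<Longrightarrow> \<theta> x = 1" "\<And>\<psi>. test_function \<psi> \<Longrightarrow> \<nu> (\<lambda>x. \<psi> x * \<theta> x) = 0"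
      using insert.prems unfolding good_def by auto
    have t: "test_function (\<lambda>x. \<psi> x * \<theta> x)" by (rule test_function_mult [OF \<psi>(1) \<theta>(1)])
    show ?case
    proof (intro exI conjI allI impI)
      show "test_function (\<lambda>x. \<psi> x - \<psi> x * \<theta> x)" by (rule test_function_diff [OF \<psi>(1) t])
      show "\<nu> (\<lambda>x. \<psi> x - \<psi> x * \<theta> x) = \<nu> \<phi>"
        using distribution_diff [OF \<nu> \<psi>(1) t] \<psi>(2) \<theta>(3) [OF \<psi>(1)] by simp
      show "\<psi> x - \<psi> x * \<theta> x = 0" if "x \<notin> fun_support \<phi> - \<Union> (insert V \<V>)" for x
        using that \<psi>(3) [of x] \<theta>(2) [of x] by auto
    qed
  qed
  then obtain \<psi> where "\<nu> \<psi> = \<nu> \<phi>" "\<And>x. \<psi> x = 0" using \<V>(3) by blast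
  then show ?thesis using distribution_zero [OF \<nu>] by (metis ext)
qed

lemma distribution_local:
  fixes \<nu> :: "(real \<times> real \<Rightarrow> complex) \<Rightarrow> complex"
  assumes \<nu>: "distribution \<nu>" and \<phi>: "test_function \<phi>" "test_function \<psi>"
    and U: "open U" "dist_support \<nu> \<subseteq> U" "\<And>x. x \<in> U \<Longrightarrow> \<phi> x = \<psi> x"
  shows "\<nu> \<phi> = \<nu> \<psi>"
proof -
  have "fun_support (\<lambda>x. \<phi> x - \<psi> x) \<subseteq> - U"
    by (rule fun_support_subset) (use U in \<open>auto simp: closed_Compl\<close>)
  then have "\<nu> (\<lambda>x. \<phi> x - \<psi> x) = 0"
    using U(2) by (intro distribution_vanishes_off_support [OF \<nu> test_function_diff [OF \<phi>]]) blast
  then show ?thesis using distribution_diff [OF \<nu> \<phi>] by simp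
qed

text \<open>The cutoff chosen in the definition of the pairing agrees with \<open>\<kappa>\<close> near the support, and \<open>\<nu>\<close> does
not see the difference elsewhere.\<close>

lemma dist_pairing_one:
  fixes \<nu> :: "(real \<times> real \<Rightarrow> complex) \<Rightarrow> complex"
  assumes \<nu>: "distribution \<nu>" and "cutoff E \<kappa>" "dist_support \<nu> \<subseteq> E"
  shows "dist_pairing \<nu> (\<lambda>_. 1) = \<nu> \<kappa>"
proof -
  define \<eta> where "\<eta> = (SOME \<eta>. cutoff (dist_support \<nu>) \<eta>)"
  have \<kappa>: "cutoff (dist_support \<nu>) \<kappa>" using assms(2,3) unfolding cutoff_def by blast
  then have \<eta>: "cutoff (dist_support \<nu>) \<eta>" unfolding \<eta>_def by (rule someI [of "cutoff (dist_support \<nu>)"])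
  obtain U where U: "open U" "dist_support \<nu> \<subseteq> U" "\<And>x. x \<in> U \<Longrightarrow> \<kappa> x = 1"
    using \<kappa> unfolding cutoff_def by blast
  obtain V where V: "open V" "dist_support \<nu> \<subseteq> V" "\<And>x. x \<in> V \<Longrightarrow> \<eta> x = 1"
    using \<eta> unfolding cutoff_def by blast
  have "\<nu> \<eta> = \<nu> \<kappa>"
    by (rule distribution_local [OF \<nu>, of _ _ "U \<inter> V"])
       (use U V \<eta> \<kappa> in \<open>auto simp: cutoff_def\<close>)
  then show ?thesis by (simp add: dist_pairing_def \<eta>_def)
qed

section \<open>The horizontal segment carries a bounded potential\<close>

lemma kernelP_alt: "kernelP p = (if snd p > 0 then snd p / ((fst p)\<^sup>2 + (snd p)\<^sup>2) else 0)"
  by (simp add: kernelP_def case_prod_beta)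

lemma kernelP_nonneg: "kernelP p \<ge> 0"
  by (simp add: kernelP_alt)

lemma kernelP_measurable [measurable]: "kernelP \<in> borel_measurable borel"
  unfolding kernelP_alt [abs_def] borel_prod [symmetric] by measurable

text \<open>The integrand is the derivative of \<open>- arctan ((x - y) / t)\<close>, a function of total variation \<open>\<pi>\<close>.\<close>

lemma kernelP_line_integral:
  assumes "0 \<le> L"
  shows "integrable lborel (\<lambda>y. kernelP (x - y, t) * indicator {0..L} y)"
    and "(LINT y|lborel. kernelP (x - y, t) * indicator {0..L} y) \<le> pi"
proof -
  have "integrable lborel (\<lambda>y. kernelP (x - y, t) * indicator {0..L} y) \<and>
        (LINT y|lborel. kernelP (x - y, t) * indicator {0..L} y) \<le> pi"
  proof (cases "t > 0")
    case True
    have pos: "(x - y)\<^sup>2 + t\<^sup>2 > 0" for y using True by (simp add: add_nonneg_pos)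
    have "((\<lambda>y. - arctan ((x - y) / t)) has_real_derivative kernelP (x - y, t)) (at y)" for y
      using True pos [of y]
      by (auto intro!: derivative_eq_intros simp: kernelP_alt power_divide field_simps power2_eq_square)
    moreover have "isCont (\<lambda>y. kernelP (x - y, t)) y" for y
      using True pos [of y] unfolding kernelP_alt by (auto intro!: continuous_intros)
    ultimately have "has_bochner_integral lborel (\<lambda>y. kernelP (x - y, t) * indicator {0..L} y)
        (- arctan ((x - L) / t) - - arctan ((x - 0) / t))"
      by (intro has_bochner_integral_FTC_Icc_real assms) auto
    moreover have "- arctan ((x - L) / t) - - arctan ((x - 0) / t) \<le> pi"
      using arctan_lbound [of "(x - L) / t"] arctan_ubound [of "(x - 0) / t"] by linarith
    ultimately show ?thesis by (simp add: has_bochner_integral_iff)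
  qed (simp add: kernelP_alt)
  then show "integrable lborel (\<lambda>y. kernelP (x - y, t) * indicator {0..L} y)"
    and "(LINT y|lborel. kernelP (x - y, t) * indicator {0..L} y) \<le> pi" by auto
qed

lemma kernelP_line_measurable:
  "(\<lambda>z. kernelP (fst (fst z) - snd z, snd (fst z)) * indicator {0..L} (snd z))
    \<in> borel_measurable (lborel \<Otimes>\<^sub>M lborel)"
proof -
  have "(\<lambda>z::(real \<times> real) \<times> real. kernelP (fst (fst z) - snd z, snd (fst z))) \<in> borel_measurable borel"
    by (intro measurable_compose [OF borel_measurable_continuous_onI kernelP_measurable] continuous_intros)
  moreover have "(\<lambda>z::(real \<times> real) \<times> real. indicat_real {0..L} (snd z)) \<in> borel_measurable borel"
    by (rule measurable_compose [OF borel_measurable_continuous_onI borel_measurable_indicator])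
      (auto intro: continuous_intros)
  ultimately show ?thesis unfolding lborel_prod measurable_lborel2 by (rule borel_measurable_times)
qed

lemma kernelP_line_integral_measurable:
  "(\<lambda>q. LINT y|lborel. kernelP (fst q - y, snd q) * indicator {0..L} y) \<in> borel_measurable lborel"
  using lborel.borel_measurable_lebesgue_integral
    [where f = "\<lambda>q y. kernelP (fst q - y, snd q) * indicator {0..L} y" and N = lborel]
    kernelP_line_measurable [of L] by (simp add: case_prod_beta')

lemma test_function_continuous_on: "test_function \<phi> \<Longrightarrow> continuous_on S \<phi>"
  by (simp add: test_function_def smooth_continuous_on)

lemma test_function_measurable: "test_function \<phi> \<Longrightarrow> \<phi> \<in> borel_measurable borel"
  by (simp add: borel_measurable_continuous_onI test_function_continuous_on)

lemma test_function_integrable: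
  assumes "test_function \<phi>"
  shows "integrable lborel \<phi>"
proof -
  have "set_integrable lborel (fun_support \<phi>) \<phi>"
    using assms borel_integrable_compact [of "fun_support \<phi>" \<phi>] test_function_continuous_on
    by (auto simp: test_function_def set_integrable_def)
  moreover have "indicator (fun_support \<phi>) x *\<^sub>R \<phi> x = \<phi> x" for x
    by (cases "x \<in> fun_support \<phi>") (auto simp: fun_support_outside)
  ultimately show ?thesis by (simp add: set_integrable_def)
qed

lemma test_function_le_Cm_norm:
  assumes "test_function \<phi>"
  shows "cmod (\<phi> x) \<le> Cm_norm 0 \<phi>"
proof -
  have "compact (fun_support \<phi>)" using assms by (simp add: test_function_def)
  then have "bounded (\<phi> ` fun_support \<phi>)"
    by (intro compact_imp_bounded compact_continuous_image test_function_continuous_on assms)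
  then obtain B where B: "\<forall>z\<in>\<phi> ` fun_support \<phi>. cmod z \<le> B" by (auto simp: bounded_iff)
  have "cmod (\<phi> y) \<le> max B 0" for y
  proof (cases "y \<in> fun_support \<phi>")
    case True
    with B have "cmod (\<phi> y) \<le> B" by simp
    then show ?thesis by simp
  next
    case False
    then show ?thesis by (simp add: fun_support_outside)
  qed
  then have "bdd_above (range (\<lambda>y. cmod (\<phi> y)))" by (rule bdd_aboveI2)
  then have "cmod (\<phi> x) \<le> (SUP x. cmod (\<phi> x))" by (rule cSUP_upper [OF UNIV_I])
  moreover have "{bs. set bs \<subseteq> Basis \<and> length bs \<le> 0} = {[] :: 'a list}" by auto
  ultimately show ?thesis by (simp add: Cm_norm_def)
qed

lemma lborel_integral_translation:
  fixes f :: "'a::euclidean_space \<Rightarrow> 'b::{banach, second_countable_topology}"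
  assumes f: "f \<in> borel_measurable borel"
  shows "(LINT x|lborel. f (c + x)) = (LINT x|lborel. f x)"
    and "integrable lborel (\<lambda>x. f (c + x)) \<longleftrightarrow> integrable lborel f"
  using integral_distr [of "(+) c" lborel borel f] integrable_distr_eq [of "(+) c" lborel borel f] f
  by (simp_all add: lborel_distr_plus)

definition segment_measure :: "real \<Rightarrow> (real \<times> real \<Rightarrow> complex) \<Rightarrow> complex" where
  "segment_measure L \<phi> = (LINT y|lborel. indicator {0..L} y *\<^sub>R \<phi> (y, 0)) / of_real pi"

lemma segment_integrable:
  assumes "test_function \<phi>"
  shows "integrable lborel (\<lambda>y. indicator {0..L::real} y *\<^sub>R \<phi> (y, 0::real))"
proof (rule borel_integrable_compact)
  show "continuous_on {0..L} (\<lambda>y. \<phi> (y, 0::real))"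
    by (rule continuous_on_compose2 [OF test_function_continuous_on [OF assms, of UNIV]])
       (auto intro!: continuous_intros)
qed simp

lemma distribution_segment:
  assumes "0 \<le> L"
  shows "distribution (segment_measure L)"
  unfolding distribution_def
proof (intro conjI allI impI)
  fix \<phi> \<psi> :: "real \<times> real \<Rightarrow> complex" assume "test_function \<phi>" "test_function \<psi>"
  then show "segment_measure L (\<lambda>x. \<phi> x + \<psi> x) = segment_measure L \<phi> + segment_measure L \<psi>"
    by (simp add: segment_measure_def scaleR_add_right add_divide_distrib segment_integrable)
next
  fix c and \<phi> :: "real \<times> real \<Rightarrow> complex" assume "test_function \<phi>"
  show "segment_measure L (\<lambda>x. c * \<phi> x) = c * segment_measure L \<phi>"
    unfolding segment_measure_def
    by (subst mult_scaleR_right [symmetric]) (simp del: mult_scaleR_right)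
next
  fix K :: "(real \<times> real) set"
  have "cmod (segment_measure L \<phi>) \<le> L / pi * Cm_norm 0 \<phi>" if \<phi>: "test_function \<phi>" for \<phi>
  proof -
    have "integrable lborel (indicat_real {0..L})" by (rule integrable_real_indicator) (simp_all add: emeasure_lborel_Icc_eq)
    then have "integrable lborel (\<lambda>y. indicat_real {0..L} y *\<^sub>R Cm_norm 0 \<phi>)" by simp
    then have "cmod (LINT y|lborel. indicator {0..L} y *\<^sub>R \<phi> (y, 0)) \<le>
        (LINT y|lborel. indicator {0..L} y *\<^sub>R Cm_norm 0 \<phi>)"
      by (rule Bochner_Integration.integral_norm_bound_integral [OF segment_integrable [OF \<phi>]])
         (simp_all add: test_function_le_Cm_norm [OF \<phi>] mult_left_mono)
    then show ?thesis using assms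
      by (simp add: segment_measure_def norm_divide field_simps)
  qed
  then show "\<exists>C m. \<forall>\<phi>. test_function \<phi> \<longrightarrow> fun_support \<phi> \<subseteq> K \<longrightarrow>
      cmod (segment_measure L \<phi>) \<le> C * Cm_norm m \<phi>" by blast
qed

lemma dist_support_segment: "dist_support (segment_measure L) \<subseteq> {0..L} \<times> {0}"
proof
  fix p assume p: "p \<in> dist_support (segment_measure L)"
  show "p \<in> {0..L} \<times> {0}"
  proof (rule ccontr)
    assume "p \<notin> {0..L} \<times> {0}"
    moreover have "open (- ({0..L} \<times> {0::real}))"
      by (intro open_Compl closed_Times) auto
    moreover have "segment_measure L \<phi> = 0" if "fun_support \<phi> \<subseteq> - ({0..L} \<times> {0})" for \<phi>
    proof -
      have eq: "indicator {0..L} y *\<^sub>R \<phi> (y, 0) = 0" for y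
      proof (cases "y \<in> {0..L}")
        case True
        with that have "(y, 0) \<notin> fun_support \<phi>" by auto
        then show ?thesis by (simp add: fun_support_outside)
      qed simp
      show ?thesis unfolding segment_measure_def eq by simp
    qed
    ultimately show False using p unfolding dist_support_def by blast
  qed
qed

text \<open>Fubini's theorem and translation invariance. Integrability on the product comes from
\<open>kernelP_line_integral\<close>, by integrating along the segment first.\<close>

lemma conv_segment:
  assumes L: "0 \<le> L" and \<phi>: "test_function \<phi>"
  shows "dist_conv (dist_of_fun (\<lambda>p. complex_of_real (kernelP p))) (segment_measure L) \<phi> =
    dist_of_fun (\<lambda>p. of_real ((LINT y|lborel. kernelP (fst p - y, snd p) * indicator {0..L} y) / pi)) \<phi>"
proof -
  define k :: "real \<times> real \<Rightarrow> real \<Rightarrow> complex" where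
    "k = (\<lambda>q y. of_real (kernelP (fst q - y, snd q) * indicator {0..L} y) * \<phi> q)"
  define h :: "real \<times> real \<Rightarrow> real \<Rightarrow> complex" where
    "h = (\<lambda>p y. of_real (kernelP p * indicator {0..L} y) * \<phi> (p + (y, 0)))"
  have \<phi>_meas: "\<phi> \<in> borel_measurable borel" by (rule test_function_measurable [OF \<phi>])
  have k_meas [measurable]: "(\<lambda>q. k q y) \<in> borel_measurable borel" for y
  proof -
    have "(\<lambda>q. kernelP (fst q - y, snd q)) \<in> borel_measurable borel"
      by (intro measurable_compose [OF borel_measurable_continuous_onI kernelP_measurable] continuous_intros)
    then show ?thesis using \<phi>_meas unfolding k_def by measurable
  qed
  \<comment> \<open>\<open>h\<close> is \<open>k\<close> in translated coordinates. The integral of \<open>\<bar>k\<bar>\<close> is controlled by integrating in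
    \<open>y\<close> first, that of \<open>\<bar>h\<bar>\<close> by integrating in the plane first.\<close>
  have kh: "k ((y, 0) + p) y = h p y" for p y
    by (simp add: k_def h_def add.commute)
  have k: "integrable (lborel \<Otimes>\<^sub>M lborel) (\<lambda>(q, y). k q y)"
  proof (rule lborel_pair.Fubini_integrable)
    show "(\<lambda>(q, y). k q y) \<in> borel_measurable (lborel \<Otimes>\<^sub>M lborel)"
    proof -
      have "(\<lambda>z. \<phi> (fst z)) \<in> borel_measurable (lborel \<Otimes>\<^sub>M (lborel :: real measure))"
        using \<phi>_meas by measurable
      then show ?thesis using kernelP_line_measurable [of L] unfolding k_def case_prod_beta by measurable
    qed
    have "(LINT y|lborel. norm (k q y)) = (LINT y|lborel. kernelP (fst q - y, snd q) * indicator {0..L} y) * cmod (\<phi> q)" for q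
      by (simp add: k_def norm_mult kernelP_nonneg)
    moreover have "integrable lborel (\<lambda>q. (LINT y|lborel. kernelP (fst q - y, snd q) * indicator {0..L} y) * cmod (\<phi> q))"
    proof (rule Bochner_Integration.integrable_bound)
      show "integrable lborel (\<lambda>q. pi * cmod (\<phi> q))"
        using test_function_integrable [OF \<phi>] by simp
      show "(\<lambda>q. (LINT y|lborel. kernelP (fst q - y, snd q) * indicator {0..L} y) * cmod (\<phi> q))
          \<in> borel_measurable lborel"
        using kernelP_line_integral_measurable [of L] \<phi>_meas by measurable
      show "AE q in lborel. norm ((LINT y|lborel. kernelP (fst q - y, snd q) * indicator {0..L} y) * cmod (\<phi> q))
          \<le> norm (pi * cmod (\<phi> q))"
        using kernelP_line_integral(2) [OF L]
        by (auto simp: abs_mult kernelP_nonneg intro!: mult_right_mono)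
    qed
    ultimately show "integrable lborel (\<lambda>q. LINT y|lborel. norm (case (q, y) of (q, y) \<Rightarrow> k q y))" by simp
    show "AE q in lborel. integrable lborel (\<lambda>y. case (q, y) of (q, y) \<Rightarrow> k q y)"
      using integrable_mult_left [OF integrable_of_real [OF kernelP_line_integral(1) [OF L]]]
      by (auto simp: k_def simp del: of_real_mult)
  qed
  have h: "integrable (lborel \<Otimes>\<^sub>M lborel) (\<lambda>(p, y). h p y)"
  proof -
    have "integrable (lborel \<Otimes>\<^sub>M lborel) (\<lambda>(y, p). h p y)"
    proof (rule lborel_pair.Fubini_integrable)
      show "(\<lambda>(y, p). h p y) \<in> borel_measurable (lborel \<Otimes>\<^sub>M lborel)"
      proof -
        have "(\<lambda>z :: real \<times> real \<times> real. \<phi> (snd z + (fst z, 0))) \<in> borel_measurable borel"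
          by (intro measurable_compose [OF borel_measurable_continuous_onI \<phi>_meas] continuous_intros)
        then have [measurable]: "(\<lambda>z :: real \<times> real \<times> real. \<phi> (snd z + (fst z, 0)))
            \<in> borel_measurable (lborel \<Otimes>\<^sub>M lborel)"
          by (simp add: lborel_prod)
        show ?thesis unfolding h_def case_prod_beta by measurable
      qed
      have "integrable lborel (\<lambda>y. LINT q|lborel. norm (k q y))"
        using lborel_pair.integrable_snd [of "\<lambda>q y. norm (k q y)"] integrable_norm [OF k]
        by (simp add: case_prod_beta')
      then show "integrable lborel (\<lambda>y. LINT p|lborel. norm (case (y, p) of (y, p) \<Rightarrow> h p y))"
        using lborel_integral_translation(1) [OF measurable_compose [OF k_meas borel_measurable_norm], of "(y, 0)" y for y] by (simp add: kh)
      show "AE y in lborel. integrable lborel (\<lambda>p. case (y, p) of (y, p) \<Rightarrow> h p y)"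
        using lborel_pair.AE_integrable_snd [OF k] lborel_integral_translation(2) [OF k_meas, of "(y, 0)" y for y] by (simp add: kh)
    qed
    from lborel_pair.integrable_product_swap [OF this] show ?thesis by simp
  qed
  have "dist_conv (dist_of_fun (\<lambda>p. complex_of_real (kernelP p))) (segment_measure L) \<phi>
      = (LINT p|lborel. LINT y|lborel. h p y) / of_real pi"
    unfolding dist_conv_def dist_of_fun_def segment_measure_def h_def
    by (simp add: scaleR_conv_of_real mult.assoc)
  also have "(LINT p|lborel. LINT y|lborel. h p y) = (LINT y|lborel. LINT p|lborel. h p y)"
    by (rule lborel_pair.Fubini_integral [OF h, symmetric])
  also have "\<dots> = (LINT y|lborel. LINT q|lborel. k q y)"
    using lborel_integral_translation(1) [OF k_meas, of "(y, 0)" y for y] by (simp add: kh)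
  also have "\<dots> = (LINT q|lborel. LINT y|lborel. k q y)"
    by (rule lborel_pair.Fubini_integral [OF k])
  also have "\<dots> / of_real pi =
     dist_of_fun (\<lambda>p. of_real ((LINT y|lborel. kernelP (fst p - y, snd p) * indicator {0..L} y) / pi)) \<phi>"
    unfolding dist_of_fun_def k_def by (simp del: of_real_mult)
  finally show ?thesis .
qed

lemma admissible_segment:
  assumes "0 \<le> L"
  shows "admissible ({0..L} \<times> {0}) (segment_measure L)"
  unfolding admissible_def Linf_norm_le_def
proof (intro conjI exI allI impI)
  let ?f = "\<lambda>p. complex_of_real ((LINT y|lborel. kernelP (fst p - y, snd p) * indicator {0..L} y) / pi)"
  show "?f \<in> borel_measurable lborel"
    using kernelP_line_integral_measurable [of L] by measurable
  show "AE p in lborel. cmod (?f p) \<le> 1"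
    using kernelP_line_integral(2) [OF assms]
    by (auto simp: norm_divide kernelP_nonneg simp del: of_real_divide)
qed (rule distribution_segment [OF assms] dist_support_segment conv_segment [OF assms], assumption?)+

lemma gamma_horizontal_segment_pos:
  assumes "0 < L"
  shows "gamma_Theta_half ({0..L} \<times> {0}) > 0"
proof -
  obtain D where D: "derivative_tower D" "\<And>x. x \<in> {0 - 1..L + 1} \<Longrightarrow> D 0 x = 1"
    "\<And>x. x \<notin> {0 - 2 * 1..L + 2 * 1} \<Longrightarrow> D 0 x = 0"
    using smooth_plateau [of 1 0 L] by (metis zero_less_one)
  obtain G where G: "derivative_tower G" "\<And>x. x \<in> {0 - 1..0 + 1} \<Longrightarrow> G 0 x = 1"
    "\<And>x. x \<notin> {0 - 2 * 1..0 + 2 * 1} \<Longrightarrow> G 0 x = 0"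
    using smooth_plateau [of 1 0 0] by (metis zero_less_one)
  have cut: "cutoff ({0..L} \<times> {0}) (tensor D G)"
    unfolding cutoff_def
  proof (intro conjI exI)
    show "test_function (tensor D G)" by (rule test_function_tensor [OF D(1) G(1) D(3) G(3)])
    show "open ({-1<..<L + 1} \<times> {-1<..<1::real})" by (intro open_Times open_greaterThanLessThan)
    show "{0..L} \<times> {0} \<subseteq> {-1<..<L + 1} \<times> {-1<..<1::real}" by auto
    show "\<forall>x\<in>{-1<..<L + 1} \<times> {-1<..<1::real}. tensor D G x = 1" by (auto simp: tensor_def D(2) G(2))
  qed
  have "segment_measure L (tensor D G) = of_real (L / pi)"
  proof -
    have eq: "indicator {0..L} y *\<^sub>R tensor D G (y, 0) = complex_of_real (indicator {0..L} y)" for y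
      by (auto simp: indicator_def tensor_def D(2) G(2))
    show ?thesis unfolding segment_measure_def eq using assms by simp
  qed
  then have "dist_pairing (segment_measure L) (\<lambda>_. 1) = of_real (L / pi)"
    using dist_pairing_one [OF distribution_segment cut dist_support_segment] assms by simp
  then have "ennreal (L / pi) = ennreal (cmod (dist_pairing (segment_measure L) (\<lambda>_. 1)))"
    using assms by (simp only: norm_of_real) simp
  also have "\<dots> \<le> gamma_Theta_half ({0..L} \<times> {0})"
    unfolding gamma_Theta_half_def using assms admissible_segment [of L] by (intro SUP_upper) auto
  finally show ?thesis using assms by (meson divide_pos_pos ennreal_less_zero_iff less_le_trans pi_gt_zero)
qed

section \<open>Distributions supported on a vertical segment\<close>

lemma distribution_sum:
  assumes \<nu>: "distribution \<nu>" and "finite I" "\<And>i. i \<in> I \<Longrightarrow> test_function (\<phi> i)"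
  shows "test_function (\<lambda>x. \<Sum>i\<in>I. c i * \<phi> i x) \<and> \<nu> (\<lambda>x. \<Sum>i\<in>I. c i * \<phi> i x) = (\<Sum>i\<in>I. c i * \<nu> (\<phi> i))"
  using assms(2,3)
proof (induction I)
  case empty
  then show ?case using distribution_zero [OF \<nu>] test_functionI [OF smooth_const, of "{}"] by simp
next
  case (insert j I)
  then have j: "test_function (\<lambda>x. c j * \<phi> j x)" by (intro test_function_cmult) simp
  have I: "test_function (\<lambda>x. \<Sum>i\<in>I. c i * \<phi> i x)"
    "\<nu> (\<lambda>x. \<Sum>i\<in>I. c i * \<phi> i x) = (\<Sum>i\<in>I. c i * \<nu> (\<phi> i))"
    using insert.IH insert.prems by auto
  have "\<nu> (\<lambda>x. c j * \<phi> j x) = c j * \<nu> (\<phi> j)"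
    using distribution_cmult [OF \<nu>] insert.prems by simp
  then show ?case
    using insert.hyps test_function_add [OF j I(1)] distribution_add [OF \<nu> j I(1)] I(2) by simp
qed

lemma tower_mult_bound:
  assumes "\<And>i. i \<le> m \<Longrightarrow> \<bar>D i x\<bar> \<le> A" "\<And>i. i \<le> m \<Longrightarrow> \<bar>G i x\<bar> \<le> B" "n \<le> m"
  shows "\<bar>tower_mult D G n x\<bar> \<le> 2 ^ m * (A * B)"
proof -
  have A: "A \<ge> 0" using assms(1) [of 0] by simp
  have B: "B \<ge> 0" using assms(2) [of 0] by simp
  have "\<bar>tower_mult D G n x\<bar> \<le> (\<Sum>k\<le>n. \<bar>real (n choose k) * D k x * G (n - k) x\<bar>)"
    unfolding tower_mult_def by (rule sum_abs)
  also have "\<dots> \<le> (\<Sum>k\<le>n. real (n choose k) * (A * B))"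
  proof (rule sum_mono)
    fix k assume "k \<in> {..n}"
    then have "\<bar>D k x\<bar> * \<bar>G (n - k) x\<bar> \<le> A * B"
      using assms A by (intro mult_mono) auto
    then show "\<bar>real (n choose k) * D k x * G (n - k) x\<bar> \<le> real (n choose k) * (A * B)"
      by (simp add: abs_mult mult.assoc mult_left_mono)
  qed
  also have "\<dots> = 2 ^ n * (A * B)"
    using choose_row_sum [of n] by (metis of_nat_numeral of_nat_power of_nat_sum sum_distrib_right)
  also have "\<dots> \<le> 2 ^ m * (A * B)"
    using assms(3) A B by (intro mult_right_mono power_increasing) auto
  finally show ?thesis .
qed

text \<open>A distribution of order \<open>m\<close>, tested on products only. The support \<open>{c..d}\<close> in the second variable
does not enter the constant, which makes the estimate invariant under translations in time.\<close>

definition tensor_order :: "((real \<times> real \<Rightarrow> complex) \<Rightarrow> complex) \<Rightarrow> real \<Rightarrow> nat \<Rightarrow> bool" where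
  "tensor_order \<nu> C m \<longleftrightarrow> (\<forall>D G A B c d.
     derivative_tower D \<longrightarrow> derivative_tower G \<longrightarrow>
     (\<forall>x. x \<notin> {-2..2} \<longrightarrow> D 0 x = 0) \<longrightarrow> (\<forall>x. x \<notin> {c..d} \<longrightarrow> G 0 x = 0) \<longrightarrow>
     (\<forall>i\<le>m. \<forall>x. \<bar>D i x\<bar> \<le> A) \<longrightarrow> (\<forall>i\<le>m. \<forall>x. \<bar>G i x\<bar> \<le> B) \<longrightarrow>
     cmod (\<nu> (tensor D G)) \<le> C * (A * B))"

lemma tensor_orderD:
  assumes "tensor_order \<nu> C m" "derivative_tower D" "derivative_tower G"
    "\<And>x. x \<notin> {-2..2} \<Longrightarrow> D 0 x = 0" "\<And>x. x \<notin> {c..d} \<Longrightarrow> G 0 x = 0"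
    "\<And>i x. i \<le> m \<Longrightarrow> \<bar>D i x\<bar> \<le> A" "\<And>i x. i \<le> m \<Longrightarrow> \<bar>G i x\<bar> \<le> B"
  shows "cmod (\<nu> (tensor D G)) \<le> C * (A * B)"
  using assms(1) [unfolded tensor_order_def, rule_format, of D G c d A B] assms(2-) by simp

text \<open>A cutoff in the second variable, equal to 1 near the segment, reduces an arbitrary second factor to
one supported in a fixed compact set, on which the seminorm estimate of \<open>\<nu>\<close> applies.\<close>

lemma tensor_order_near_segment:
  assumes \<nu>: "distribution \<nu>" and supp: "dist_support \<nu> \<subseteq> {0} \<times> {0..L}"
  obtains C m where "0 < C" "tensor_order \<nu> C m"
proof -
  have "compact ({-2..2::real} \<times> {0 - 2 * 1..L + 2 * 1})" by (intro compact_Times compact_Icc)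
  then obtain C0 m where C0: "\<And>\<phi>. \<lbrakk>test_function \<phi>; fun_support \<phi> \<subseteq> {-2..2} \<times> {0 - 2 * 1..L + 2 * 1}\<rbrakk>
      \<Longrightarrow> cmod (\<nu> \<phi>) \<le> C0 * Cm_norm m \<phi>"
    using \<nu> unfolding distribution_def by metis
  obtain b where b: "derivative_tower b" "\<And>x. x \<in> {0 - 1..L + 1} \<Longrightarrow> b 0 x = 1"
      "\<And>x. x \<notin> {0 - 2 * 1..L + 2 * 1} \<Longrightarrow> b 0 x = 0"
    using smooth_plateau [of 1 0 L] by (metis zero_less_one)
  obtain Bb where Bb: "0 < Bb" "\<And>n x. n \<le> m \<Longrightarrow> \<bar>b n x\<bar> \<le> Bb"
    using tower_bounded [OF b(1,3)] by metis
  define N where "N = real (card {bs. set bs \<subseteq> (Basis :: (real \<times> real) set) \<and> length bs \<le> m})"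
  show ?thesis
  proof
    show "0 < (\<bar>C0\<bar> + 1) * (N + 1) * (2 ^ m * Bb)"
      using Bb(1) by (simp add: N_def add_nonneg_pos)
    show "tensor_order \<nu> ((\<bar>C0\<bar> + 1) * (N + 1) * (2 ^ m * Bb)) m"
      unfolding tensor_order_def
    proof (intro allI impI)
      fix D G :: "nat \<Rightarrow> real \<Rightarrow> real" and A B c d :: real
      assume D: "derivative_tower D" and G: "derivative_tower G"
        and "\<forall>x. x \<notin> {-2..2} \<longrightarrow> D 0 x = 0" "\<forall>x. x \<notin> {c..d} \<longrightarrow> G 0 x = 0"
        and "\<forall>i\<le>m. \<forall>x. \<bar>D i x\<bar> \<le> A" "\<forall>i\<le>m. \<forall>x. \<bar>G i x\<bar> \<le> B"
      then have D0: "\<And>x. x \<notin> {-2..2} \<Longrightarrow> D 0 x = 0" and G0: "\<And>x. x \<notin> {c..d} \<Longrightarrow> G 0 x = 0"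
        and DA: "\<And>i x. i \<le> m \<Longrightarrow> \<bar>D i x\<bar> \<le> A" and GB: "\<And>i x. i \<le> m \<Longrightarrow> \<bar>G i x\<bar> \<le> B"
        by blast+
      have A: "A \<ge> 0" using DA [of 0 0] by simp
      have B: "B \<ge> 0" using GB [of 0 0] by simp
      define H where "H = tower_mult b G"
      have H: "derivative_tower H" unfolding H_def by (rule derivative_tower_mult [OF b(1) G])
      have H0: "H 0 x = 0" if "x \<notin> {0 - 2 * 1..L + 2 * 1}" for x
        unfolding H_def by (simp only: tower_mult_0 b(3) [OF that] mult_zero_left)
      have HB: "\<bar>H i x\<bar> \<le> 2 ^ m * (Bb * B)" if "i \<le> m" for i x
        unfolding H_def by (rule tower_mult_bound) (fact Bb(2) GB that)+
      have tH: "test_function (tensor D H)" by (rule test_function_tensor [OF D H D0 H0])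
      have "\<nu> (tensor D G) = \<nu> (tensor D H)"
      proof (rule distribution_local [OF \<nu> test_function_tensor [OF D G D0 G0] tH])
        show "open (UNIV \<times> {-1<..<L + 1} :: (real \<times> real) set)"
          by (intro open_Times open_UNIV open_greaterThanLessThan)
        show "dist_support \<nu> \<subseteq> UNIV \<times> {-1<..<L + 1}"
          by (rule order_trans [OF supp]) auto
        show "tensor D G x = tensor D H x" if "x \<in> UNIV \<times> {-1<..<L + 1}" for x
          using that b(2) [of "snd x"] by (simp add: tensor_def H_def mem_Times_iff)
      qed
      also have "cmod \<dots> \<le> C0 * Cm_norm m (tensor D H)"
      proof (rule C0 [OF tH], rule fun_support_subset)
        show "closed ({-2..2::real} \<times> {0 - 2 * 1..L + 2 * 1})" by (intro closed_Times closed_atLeastAtMost)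
        show "tensor D H x = 0" if "x \<notin> {-2..2} \<times> {0 - 2 * 1..L + 2 * 1}" for x
          by (rule tensor_outside [where A = "{-2..2}" and B = "{0 - 2 * 1..L + 2 * 1}"]) (fact D0 H0 that)+
      qed
      also have "\<dots> \<le> \<bar>C0\<bar> * (N * (A * (2 ^ m * (Bb * B))))"
      proof -
        have le: "\<bar>Cm_norm m (tensor D H)\<bar> \<le> N * (A * (2 ^ m * (Bb * B)))"
          unfolding N_def by (rule Cm_norm_tensor_le [OF D H DA HB])
        have "C0 * Cm_norm m (tensor D H) \<le> \<bar>C0\<bar> * \<bar>Cm_norm m (tensor D H)\<bar>"
          by (simp flip: abs_mult)
        also have "\<dots> \<le> \<bar>C0\<bar> * (N * (A * (2 ^ m * (Bb * B))))" using le by (rule mult_left_mono) simp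
        finally show ?thesis .
      qed
      also have "\<dots> = \<bar>C0\<bar> * N * (2 ^ m * Bb) * (A * B)" by simp
      also have "\<dots> \<le> (\<bar>C0\<bar> + 1) * (N + 1) * (2 ^ m * Bb) * (A * B)"
        using A B Bb(1) by (intro mult_mono mult_nonneg_nonneg) (auto simp: N_def)
      finally show "cmod (\<nu> (tensor D G)) \<le> (\<bar>C0\<bar> + 1) * (N + 1) * (2 ^ m * Bb) * (A * B)" .
    qed
  qed
qed

text \<open>Taylor's estimate for a function flat of order \<open>m\<close>, by repeated use of the mean value theorem
downwards from the derivative of order \<open>m + 1\<close>.\<close>

lemma flat_tower_bound:
  assumes w: "derivative_tower w" and 0: "\<And>k. k \<le> m \<Longrightarrow> w k 0 = 0"
    and W: "\<And>x. \<bar>w (Suc m) x\<bar> \<le> W"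
  shows "j \<le> Suc m \<Longrightarrow> \<bar>w j x\<bar> \<le> W * \<bar>x\<bar> ^ (Suc m - j)"
proof (induction "Suc m - j" arbitrary: j x)
  case 0
  then show ?case using W [of x] by simp
next
  case (Suc i)
  then have j: "j \<le> m" "Suc m - Suc j = i" "Suc m - j = Suc i" by auto
  have IH: "\<bar>w (Suc j) y\<bar> \<le> W * \<bar>y\<bar> ^ i" for y
    using Suc.hyps(1) [of "Suc j" y] j by simp
  have W0: "W \<ge> 0" using W [of 0] by simp
  have "norm (w j x - w j 0) \<le> (W * \<bar>x\<bar> ^ i) * norm (x - 0)"
  proof (rule field_differentiable_bound [of "{-\<bar>x\<bar>..\<bar>x\<bar>}"])
    fix z assume z: "z \<in> {-\<bar>x\<bar>..\<bar>x\<bar>}"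
    show "(w j has_field_derivative w (Suc j) z) (at z within {-\<bar>x\<bar>..\<bar>x\<bar>})"
      by (rule has_field_derivative_at_within [OF tower_deriv [OF w]])
    have "\<bar>w (Suc j) z\<bar> \<le> W * \<bar>z\<bar> ^ i" by (rule IH)
    also have "\<dots> \<le> W * \<bar>x\<bar> ^ i" using z W0 by (intro mult_left_mono power_mono) auto
    finally show "norm (w (Suc j) z) \<le> W * \<bar>x\<bar> ^ i" by simp
  qed auto
  then show ?case using 0 [OF j(1)] j(3) by (simp add: algebra_simps)
qed

text \<open>A distribution of order \<open>m\<close> supported on a line involves at most \<open>m\<close> derivatives across it. The
function is cut off at distance \<open>\<delta>\<close> from the line, which does not change the value of \<open>\<nu>\<close>, and
its norm tends to 0 with \<open>\<delta>\<close>.\<close>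

lemma transversally_flat_annihilated:
  assumes \<nu>: "distribution \<nu>" and supp: "dist_support \<nu> \<subseteq> {0} \<times> {0..L}"
    and C: "tensor_order \<nu> C m"
    and w: "derivative_tower w" "\<And>x. x \<notin> {-2..2} \<Longrightarrow> w 0 x = 0" "\<And>k. k \<le> m \<Longrightarrow> w k 0 = 0"
    and a: "derivative_tower a" "\<And>x. x \<notin> {c..d} \<Longrightarrow> a 0 x = 0"
  shows "\<nu> (tensor w a) = 0"
proof -
  obtain W where W: "0 < W" "\<And>n x. n \<le> Suc m \<Longrightarrow> \<bar>w n x\<bar> \<le> W"
    using tower_bounded [OF w(1,2)] by metis
  obtain B where B: "0 < B" "\<And>n x. n \<le> m \<Longrightarrow> \<bar>a n x\<bar> \<le> B"
    using tower_bounded [OF a] by metis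
  obtain \<theta> where \<theta>: "derivative_tower \<theta>" "\<And>x. x \<in> {0 - 1..0 + 1} \<Longrightarrow> \<theta> 0 x = 1"
      "\<And>x. x \<notin> {0 - 2 * 1..0 + 2 * 1} \<Longrightarrow> \<theta> 0 x = 0"
    using smooth_plateau [of 1 0 0] by (metis zero_less_one)
  obtain X where X: "0 < X" "\<And>n x. n \<le> m \<Longrightarrow> \<bar>\<theta> n x\<bar> \<le> X"
    using tower_bounded [OF \<theta>(1,3)] by metis
  have flat: "\<bar>w j x\<bar> \<le> W * \<bar>x\<bar> ^ (Suc m - j)" if "j \<le> Suc m" for j x
    by (rule flat_tower_bound [OF w(1) _ _ that]) (use w(3) W(2) in auto)
  \<comment> \<open>Cutting off at \<open>\<bar>x\<bar> \<le> 2 * \<delta>\<close> costs \<open>\<delta>\<close> to the power \<open>-k\<close> for \<open>k\<close> derivatives, but flatness of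
    order \<open>m + 1\<close> gains one power of \<open>\<delta>\<close> more than \<open>m\<close> derivatives can lose.\<close>
  define K where "K = 2 ^ m * (X * W * 2 ^ Suc m)"
  have bound: "cmod (\<nu> (tensor w a)) \<le> C * (K * \<delta> * B)" if \<delta>: "0 < \<delta>" "\<delta> \<le> 1" for \<delta>
  proof -
    define \<theta>' where "\<theta>' = (\<lambda>n x. (1 / \<delta>) ^ n * \<theta> n (1 / \<delta> * x + 0))"
    define v where "v = tower_mult \<theta>' w"
    have \<theta>': "derivative_tower \<theta>'" unfolding \<theta>'_def by (rule derivative_tower_affine [OF \<theta>(1)])
    have v: "derivative_tower v" unfolding v_def by (rule derivative_tower_mult [OF \<theta>' w(1)])
    have v_out: "v 0 x = 0" if "x \<in> - {- (2 * \<delta>)..2 * \<delta>}" for x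
    proof -
      have "x / \<delta> \<notin> {0 - 2 * 1..0 + 2 * 1}" using that \<delta> by (auto simp: field_simps)
      then have "\<theta> 0 (x / \<delta>) = 0" by (rule \<theta>(3))
      then show ?thesis by (simp add: v_def \<theta>'_def)
    qed
    have v_bound: "\<bar>v n x\<bar> \<le> K * \<delta>" if n: "n \<le> m" for n x
    proof (cases "x \<in> - {- (2 * \<delta>)..2 * \<delta>}")
      case True
      have "open (- {- (2 * \<delta>)..2 * \<delta>})" by (intro open_Compl closed_atLeastAtMost)
      from tower_vanishes [OF v this v_out True] show ?thesis
        using \<delta> X W by (simp add: K_def)
    next
      case False
      then have x: "\<bar>x\<bar> \<le> 2 * \<delta>" by auto
      have "\<bar>v n x\<bar> \<le> (\<Sum>k\<le>n. \<bar>real (n choose k) * \<theta>' k x * w (n - k) x\<bar>)"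
        unfolding v_def tower_mult_def by (rule sum_abs)
      also have "\<dots> \<le> (\<Sum>k\<le>n. real (n choose k) * (X * W * 2 ^ Suc m * \<delta>))"
      proof (rule sum_mono)
        fix k assume k: "k \<in> {..n}"
        have "\<bar>\<theta>' k x\<bar> \<le> (1 / \<delta>) ^ k * X"
          using X(2) [of k "1 / \<delta> * x + 0"] k n \<delta> by (simp add: \<theta>'_def abs_mult divide_right_mono power_divide)
        moreover have "\<bar>w (n - k) x\<bar> \<le> W * (2 * \<delta>) ^ (Suc m - (n - k))"
        proof -
          have "\<bar>w (n - k) x\<bar> \<le> W * \<bar>x\<bar> ^ (Suc m - (n - k))" using n by (intro flat) auto
          also have "\<dots> \<le> W * (2 * \<delta>) ^ (Suc m - (n - k))"
            using x W(1) by (intro mult_left_mono power_mono) auto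
          finally show ?thesis .
        qed
        ultimately have "\<bar>\<theta>' k x\<bar> * \<bar>w (n - k) x\<bar> \<le> (1 / \<delta>) ^ k * X * (W * (2 * \<delta>) ^ (Suc m - (n - k)))"
          using \<delta> X(1) by (intro mult_mono) auto
        also have "\<dots> = X * W * 2 ^ (Suc m - (n - k)) * \<delta> ^ (Suc m - n)"
        proof -
          have "Suc m - (n - k) = k + (Suc m - n)" using k n by auto
          then show ?thesis using \<delta>(1) by (simp add: power_add power_mult_distrib power_divide)
        qed
        also have "\<dots> \<le> X * W * 2 ^ Suc m * \<delta>"
        proof -
          have "(2::real) ^ (Suc m - (n - k)) \<le> 2 ^ Suc m" by (rule power_increasing) auto
          moreover have "\<delta> ^ (Suc m - n) \<le> \<delta> ^ 1" using n \<delta> by (intro power_decreasing) auto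
          ultimately show ?thesis using X(1) W(1) \<delta> by (intro mult_mono) auto
        qed
        finally show "\<bar>real (n choose k) * \<theta>' k x * w (n - k) x\<bar> \<le> real (n choose k) * (X * W * 2 ^ Suc m * \<delta>)"
          by (simp only: abs_mult mult.assoc abs_of_nat) (rule mult_left_mono, simp_all)
      qed
      also have "\<dots> = 2 ^ n * (X * W * 2 ^ Suc m * \<delta>)"
        using choose_row_sum [of n] by (metis of_nat_numeral of_nat_power of_nat_sum sum_distrib_right)
      also have "\<dots> \<le> 2 ^ m * (X * W * 2 ^ Suc m * \<delta>)"
        using n X(1) W(1) \<delta> by (intro mult_right_mono power_increasing) auto
      finally show ?thesis by (simp add: K_def mult.assoc)
    qed
    have v0: "v 0 x = 0" if "x \<notin> {-2..2}" for x
      using w(2) [OF that] by (simp add: v_def)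
    have "\<nu> (tensor w a) = \<nu> (tensor v a)"
    proof (rule distribution_local [OF \<nu>])
      show "test_function (tensor w a)" by (rule test_function_tensor) (fact w a)+
      show "test_function (tensor v a)" by (rule test_function_tensor) (fact v v0 a)+
      show "open ({-\<delta><..<\<delta>} \<times> UNIV :: (real \<times> real) set)"
        by (intro open_Times open_UNIV open_greaterThanLessThan)
      show "dist_support \<nu> \<subseteq> {-\<delta><..<\<delta>} \<times> UNIV"
        using \<delta> by (intro order_trans [OF supp]) auto
      show "tensor w a p = tensor v a p" if "p \<in> {-\<delta><..<\<delta>} \<times> UNIV" for p
      proof -
        have "fst p / \<delta> \<in> {0 - 1..0 + 1}" using that \<delta> by (auto simp: mem_Times_iff field_simps)
        then have "\<theta> 0 (fst p / \<delta>) = 1" by (rule \<theta>(2))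
        then show ?thesis by (simp add: tensor_def v_def \<theta>'_def)
      qed
    qed
    also have "cmod \<dots> \<le> C * (K * \<delta> * B)"
      by (rule tensor_orderD [OF C]) (fact v v0 a v_bound B)+
    finally show ?thesis .
  qed
  have "cmod (\<nu> (tensor w a)) \<le> 0"
  proof (rule tendsto_lowerbound)
    show "((\<lambda>\<delta>. C * (K * \<delta> * B)) \<longlongrightarrow> 0) (at_right 0)"
      by (auto intro!: tendsto_eq_intros)
    show "\<forall>\<^sub>F \<delta> in at_right 0. cmod (\<nu> (tensor w a)) \<le> C * (K * \<delta> * B)"
      using bound by (auto simp: eventually_at_right_field intro!: exI [of _ 1])
  qed simp
  then show ?thesis by simp
qed

text \<open>The coefficient that \<open>\<nu>\<close> assigns to the derivative of order \<open>k\<close> across the line, smoothed in time by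
the profile \<open>a\<close> translated by \<open>t\<close>. The factor \<open>\<theta>\<close> only makes the monomial compactly supported.\<close>

definition transversal_moment :: "((real \<times> real \<Rightarrow> complex) \<Rightarrow> complex) \<Rightarrow> (nat \<Rightarrow> real \<Rightarrow> real) \<Rightarrow>
    (nat \<Rightarrow> real \<Rightarrow> real) \<Rightarrow> nat \<Rightarrow> real \<Rightarrow> complex" where
  "transversal_moment \<nu> \<theta> a k t = \<nu> (tensor (tower_mult \<theta> (power_tower k)) (\<lambda>n s. a n (t + s)))"

text \<open>The profile \<open>a\<close> equals 1 on an interval exceeding the segment by one unit below and two above.
Therefore translating it by up to one unit cannot be noticed by \<open>\<nu>\<close>, and translating it by at
least \<open>L + 4\<close> moves it off the segment.\<close>

context
  fixes \<nu> :: "(real \<times> real \<Rightarrow> complex) \<Rightarrow> complex" and \<theta> a :: "nat \<Rightarrow> real \<Rightarrow> real" and L :: real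
  assumes \<nu>: "distribution \<nu>" and supp: "dist_support \<nu> \<subseteq> {0} \<times> {0..L}"
    and \<theta>: "derivative_tower \<theta>" "\<And>x. x \<in> {-1..1} \<Longrightarrow> \<theta> 0 x = 1" "\<And>x. x \<notin> {-2..2} \<Longrightarrow> \<theta> 0 x = 0"
    and a: "derivative_tower a" "\<And>x. x \<in> {-1..L + 2} \<Longrightarrow> a 0 x = 1" "\<And>x. x \<notin> {-2..L + 3} \<Longrightarrow> a 0 x = 0"
begin

lemma shifted_profile: "derivative_tower (\<lambda>n s. a n (t + s))"
  by (rule derivative_tower_shift [OF a(1)])

lemma shifted_profile_outside: "s \<notin> {-2 - t..L + 3 - t} \<Longrightarrow> a 0 (t + s) = 0"
  by (rule a(3)) auto

lemma cut_power: "derivative_tower (tower_mult \<theta> (power_tower k))"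
  by (rule derivative_tower_mult [OF \<theta>(1) derivative_tower_power])

lemma cut_power_outside: "x \<notin> {-2..2} \<Longrightarrow> tower_mult \<theta> (power_tower k) 0 x = 0"
  using \<theta>(3) [of x] by (simp del: atLeastAtMost_iff)

lemma test_function_cut_power: "test_function (tensor (tower_mult \<theta> (power_tower k)) (\<lambda>n s. a n (t + s)))"
  by (rule test_function_tensor) (fact cut_power shifted_profile cut_power_outside shifted_profile_outside)+

text \<open>The Taylor expansion of \<open>y \<mapsto> g (x + y)\<close> up to order \<open>m\<close>: its remainder is transversally flat, hence
annihilated by \<open>\<nu>\<close>.\<close>

lemma transversal_expansion:
  assumes C: "tensor_order \<nu> C m"
    and g: "derivative_tower g" "\<And>x. x \<notin> {c..d} \<Longrightarrow> g 0 x = 0"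
  shows "\<nu> (\<lambda>q. tensor g a ((x, t) + q)) = (\<Sum>k\<le>m. of_real (g k x) * transversal_moment \<nu> \<theta> a k t)"
proof -
  let ?a = "\<lambda>n s. a n (t + s)" and ?g = "\<lambda>n y. g n (x + y)"
  \<comment> \<open>The Taylor remainder of \<open>g\<close> at \<open>x\<close>, as a function of the transversal variable \<open>y\<close>.\<close>
  define r where "r = (\<lambda>n y. ?g n y - (\<Sum>k\<in>{..m}. g k x * power_tower k n y))"
  have g': "derivative_tower ?g" by (rule derivative_tower_shift [OF g(1)])
  have g'_out: "?g 0 y = 0" if "y \<notin> {c - x..d - x}" for y by (rule g(2)) (use that in auto)
  have r: "derivative_tower r"
    unfolding r_def
    by (intro derivative_tower_diff derivative_tower_sum derivative_tower_power g')
  have r0: "r n 0 = 0" if "n \<le> m" for n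
  proof -
    have "(\<Sum>k\<in>{..m}. g k x * power_tower k n 0) = (\<Sum>k\<in>{..m}. if k = n then g n x else 0)"
      by (intro sum.cong) (auto simp: power_tower_def)
    then show ?thesis using that by (simp add: r_def)
  qed
  have out: "tower_mult \<theta> G 0 y = 0" if "y \<notin> {-2..2}" for G y
    by (simp only: tower_mult_0 \<theta>(3) [OF that] mult_zero_left)
  have flat: "\<nu> (tensor (tower_mult \<theta> r) ?a) = 0"
  proof (rule transversally_flat_annihilated [OF \<nu> supp C])
    show "derivative_tower (tower_mult \<theta> r)" by (rule derivative_tower_mult [OF \<theta>(1) r])
    show "tower_mult \<theta> r k 0 = 0" if "k \<le> m" for k
      unfolding tower_mult_def by (rule sum.neutral) (use that r0 in auto)
  qed (fact out shifted_profile shifted_profile_outside)+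
  define S where "S = (\<lambda>q. \<Sum>k\<in>{..m}. of_real (g k x) * tensor (tower_mult \<theta> (power_tower k)) ?a q)"
  have S: "test_function S" "\<nu> S = (\<Sum>k\<le>m. of_real (g k x) * transversal_moment \<nu> \<theta> a k t)"
    using distribution_sum [OF \<nu> finite_atMost [of m] test_function_cut_power [of _ t]]
    by (simp_all add: S_def transversal_moment_def)
  have "(\<lambda>q. tensor g a ((x, t) + q)) = tensor ?g ?a" by (simp add: tensor_def fun_eq_iff)
  moreover have "\<nu> (tensor ?g ?a) = \<nu> (tensor (tower_mult \<theta> ?g) ?a)"
  proof (rule distribution_local [OF \<nu>])
    show "test_function (tensor ?g ?a)"
      by (rule test_function_tensor) (fact g' g'_out shifted_profile shifted_profile_outside)+
    show "test_function (tensor (tower_mult \<theta> ?g) ?a)"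
      by (rule test_function_tensor)
        (fact derivative_tower_mult [OF \<theta>(1) g'] out shifted_profile shifted_profile_outside)+
    show "open ({-1<..<1} \<times> UNIV :: (real \<times> real) set)"
      by (intro open_Times open_UNIV open_greaterThanLessThan)
    show "dist_support \<nu> \<subseteq> {-1<..<1} \<times> UNIV" by (rule order_trans [OF supp]) auto
    show "tensor ?g ?a p = tensor (tower_mult \<theta> ?g) ?a p" if "p \<in> {-1<..<1} \<times> UNIV" for p
      using that \<theta>(2) [of "fst p"] by (simp add: tensor_def mem_Times_iff)
  qed
  moreover have "tensor (tower_mult \<theta> ?g) ?a = (\<lambda>q. S q + tensor (tower_mult \<theta> r) ?a q)"
  proof
    fix q
    have "complex_of_real (\<theta> 0 (fst q) * g 0 (x + fst q) * a 0 (t + snd q))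
      = complex_of_real ((\<Sum>k\<in>{..m}. g k x * (\<theta> 0 (fst q) * power_tower k 0 (fst q) * a 0 (t + snd q)))
          + \<theta> 0 (fst q) * (g 0 (x + fst q) - (\<Sum>k\<in>{..m}. g k x * power_tower k 0 (fst q))) * a 0 (t + snd q))"
      by (simp only: of_real_eq_iff) (simp add: algebra_simps sum_distrib_left sum_distrib_right)
    then show "tensor (tower_mult \<theta> ?g) ?a q = S q + tensor (tower_mult \<theta> r) ?a q"
      by (simp add: tensor_def S_def r_def)
  qed
  moreover have "\<nu> (\<lambda>q. S q + tensor (tower_mult \<theta> r) ?a q) = \<nu> S + \<nu> (tensor (tower_mult \<theta> r) ?a)"
    by (rule distribution_add [OF \<nu> S(1)], rule test_function_tensor)
      (fact derivative_tower_mult [OF \<theta>(1) r] out shifted_profile shifted_profile_outside)+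
  ultimately show ?thesis using S(2) flat by simp
qed

lemma transversal_moment_early:
  assumes "0 \<le> t" "t \<le> 1"
  shows "transversal_moment \<nu> \<theta> a k t = transversal_moment \<nu> \<theta> a k 0"
  unfolding transversal_moment_def
proof (rule distribution_local [OF \<nu> test_function_cut_power test_function_cut_power])
  show "open (UNIV \<times> {-1<..<L + 1} :: (real \<times> real) set)"
    by (intro open_Times open_UNIV open_greaterThanLessThan)
  show "dist_support \<nu> \<subseteq> UNIV \<times> {-1<..<L + 1}" by (rule order_trans [OF supp]) auto
  fix p :: "real \<times> real" assume "p \<in> UNIV \<times> {-1<..<L + 1}"
  then have "a 0 (t + snd p) = 1" "a 0 (0 + snd p) = 1"
    using assms by (auto intro!: a(2) simp: mem_Times_iff)
  then show "tensor (tower_mult \<theta> (power_tower k)) (\<lambda>n s. a n (t + s)) p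
      = tensor (tower_mult \<theta> (power_tower k)) (\<lambda>n s. a n (0 + s)) p"
    by (simp add: tensor_def)
qed

lemma transversal_moment_late:
  assumes "L + 4 \<le> t"
  shows "transversal_moment \<nu> \<theta> a k t = 0"
proof -
  have "\<nu> (tensor (tower_mult \<theta> (power_tower k)) (\<lambda>n s. a n (t + s))) = \<nu> (\<lambda>_. 0)"
  proof (rule distribution_local [OF \<nu> test_function_cut_power])
    show "test_function (\<lambda>_ :: real \<times> real. 0)" by (rule test_functionI [OF smooth_const, of "{}"]) auto
    show "open (UNIV \<times> {-1<..} :: (real \<times> real) set)"
      by (intro open_Times open_UNIV open_greaterThan)
    show "dist_support \<nu> \<subseteq> UNIV \<times> {-1<..}" by (rule order_trans [OF supp]) auto
    fix p :: "real \<times> real" assume "p \<in> UNIV \<times> {-1<..}"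
    then have "a 0 (t + snd p) = 0"
      using assms by (intro a(3)) (auto simp: mem_Times_iff)
    then show "tensor (tower_mult \<theta> (power_tower k)) (\<lambda>n s. a n (t + s)) p = 0" by (simp add: tensor_def)
  qed
  then show ?thesis using distribution_zero [OF \<nu>] by (simp add: transversal_moment_def)
qed

text \<open>At \<open>k = 0\<close> and \<open>t = 0\<close> the test function is a cutoff of the segment.\<close>

lemma transversal_moment_zero: "dist_pairing \<nu> (\<lambda>_. 1) = transversal_moment \<nu> \<theta> a 0 0"
  unfolding transversal_moment_def
proof (rule dist_pairing_one [OF \<nu> _ supp])
  show "cutoff ({0} \<times> {0..L}) (tensor (tower_mult \<theta> (power_tower 0)) (\<lambda>n s. a n (0 + s)))"
    unfolding cutoff_def
  proof (intro conjI exI [of _ "{-1<..<1} \<times> {-1<..<L + 1}"])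
    show "test_function (tensor (tower_mult \<theta> (power_tower 0)) (\<lambda>n s. a n (0 + s)))"
      by (rule test_function_cut_power)
    show "open ({-1<..<1} \<times> {-1<..<L + 1} :: (real \<times> real) set)"
      by (intro open_Times open_greaterThanLessThan)
  qed (auto simp: tensor_def power_tower_def \<theta>(2) a(2))
qed

lemma transversal_moment_bounded:
  assumes C: "tensor_order \<nu> C m"
  obtains M where "\<And>t. cmod (transversal_moment \<nu> \<theta> a k t) \<le> M"
proof -
  obtain A where A: "\<And>n x. n \<le> m \<Longrightarrow> \<bar>a n x\<bar> \<le> A" using tower_bounded [OF a(1,3)] by metis
  obtain X where X: "\<And>n x. n \<le> m \<Longrightarrow> \<bar>tower_mult \<theta> (power_tower k) n x\<bar> \<le> X"
    using tower_bounded [OF cut_power cut_power_outside] by metis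
  show ?thesis
  proof
    show "cmod (transversal_moment \<nu> \<theta> a k t) \<le> C * (X * A)" for t
      unfolding transversal_moment_def
      by (rule tensor_orderD [OF C])
        (fact cut_power shifted_profile cut_power_outside shifted_profile_outside X A)+
  qed
qed

text \<open>Lipschitz continuity, from the mean value theorem for the derivatives of \<open>a\<close> up to order \<open>m + 1\<close>.\<close>

lemma transversal_moment_continuous:
  assumes C: "tensor_order \<nu> C m" and "C > 0"
  shows "continuous_on S (transversal_moment \<nu> \<theta> a k)"
proof -
  obtain A where A: "0 < A" "\<And>n x. n \<le> Suc m \<Longrightarrow> \<bar>a n x\<bar> \<le> A" using tower_bounded [OF a(1,3)] by metis
  obtain X where X: "0 < X" "\<And>n x. n \<le> m \<Longrightarrow> \<bar>tower_mult \<theta> (power_tower k) n x\<bar> \<le> X"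
    using tower_bounded [OF cut_power cut_power_outside] by metis
  have lip: "cmod (transversal_moment \<nu> \<theta> a k t - transversal_moment \<nu> \<theta> a k t') \<le> C * X * A * \<bar>t - t'\<bar>" for t t'
  proof -
    define b where "b = (\<lambda>n s. a n (t + s) - a n (t' + s))"
    have b: "derivative_tower b" unfolding b_def by (intro derivative_tower_diff shifted_profile)
    have b0: "b 0 s = 0" if "s \<notin> {min (-2 - t) (-2 - t')..max (L + 3 - t) (L + 3 - t')}" for s
    proof -
      have "a 0 (t + s) = 0" "a 0 (t' + s) = 0"
        using that by (auto intro!: a(3) simp: min_def max_def split: if_splits)
      then show ?thesis by (simp add: b_def)
    qed
    have bB: "\<bar>b n s\<bar> \<le> A * \<bar>t - t'\<bar>" if "n \<le> m" for n s
    proof -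
      have "norm (a n (t + s) - a n (t' + s)) \<le> A * norm ((t + s) - (t' + s))"
        by (rule field_differentiable_bound [of UNIV _ "a (Suc n)"])
          (use A that in \<open>auto intro: tower_deriv [OF a(1)]\<close>)
      then show ?thesis by (simp add: b_def)
    qed
    have "transversal_moment \<nu> \<theta> a k t - transversal_moment \<nu> \<theta> a k t'
        = \<nu> (\<lambda>q. tensor (tower_mult \<theta> (power_tower k)) (\<lambda>n s. a n (t + s)) q
            - tensor (tower_mult \<theta> (power_tower k)) (\<lambda>n s. a n (t' + s)) q)"
      unfolding transversal_moment_def
      by (rule distribution_diff [OF \<nu> test_function_cut_power test_function_cut_power, symmetric])
    also have "\<dots> = \<nu> (tensor (tower_mult \<theta> (power_tower k)) b)"
      by (rule arg_cong [of _ _ \<nu>]) (simp add: tensor_def b_def fun_eq_iff algebra_simps)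
    also have "cmod \<dots> \<le> C * (X * (A * \<bar>t - t'\<bar>))"
      by (rule tensor_orderD [OF C]) (fact cut_power b cut_power_outside b0 X bB)+
    finally show ?thesis by (simp add: mult.assoc)
  qed
  have "continuous_on UNIV (transversal_moment \<nu> \<theta> a k)"
    unfolding continuous_on_iff
  proof (intro ballI allI impI)
    fix t e :: real assume "e > 0"
    have pos: "C * X * A > 0" using \<open>C > 0\<close> X A by simp
    show "\<exists>d>0. \<forall>t'\<in>UNIV. dist t' t < d \<longrightarrow>
        dist (transversal_moment \<nu> \<theta> a k t') (transversal_moment \<nu> \<theta> a k t) < e"
    proof (intro exI conjI ballI impI)
      show "e / (C * X * A) > 0" using pos \<open>e > 0\<close> by simp
      fix t' assume "dist t' t < e / (C * X * A)"
      then have "C * X * A * \<bar>t' - t\<bar> < e" using pos by (simp add: dist_real_def field_simps)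
      then show "dist (transversal_moment \<nu> \<theta> a k t') (transversal_moment \<nu> \<theta> a k t) < e"
        using lip [of t' t] by (simp add: dist_norm)
    qed
  qed
  then show ?thesis by (rule continuous_on_subset) simp
qed

end

section \<open>Logarithms against polynomials\<close>

text \<open>Induction on the degree: passing from \<open>f z\<close> to \<open>f (2 * z) - 2 ^ m * f z\<close> kills the term of degree
\<open>m\<close>, keeps the boundedness, and multiplies the coefficient of the logarithm by \<open>1 - 2 ^ m\<close>, which
is nonzero for \<open>m \<ge> 1\<close>.\<close>

lemma log_dominated_by_polynomial:
  fixes C :: complex and e :: "nat \<Rightarrow> complex"
  assumes "\<And>z::real. z \<ge> 1 \<Longrightarrow> cmod (C * of_real (ln z) + (\<Sum>k\<le>m. e k * of_real z ^ k)) \<le> A"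
  shows "C = 0"
  using assms
proof (induction m arbitrary: C e A)
  case 0
  show ?case
  proof (rule ccontr)
    assume "C \<noteq> 0"
    then have C: "cmod C > 0" by simp
    have A: "A \<ge> 0" by (rule order_trans [OF norm_ge_zero "0" [of 1]]) simp
    define w where "w = (A + cmod (e 0) + 1) / cmod C"
    have w: "w \<ge> 0" using A C by (simp add: w_def)
    then have "cmod (C * of_real w + e 0) \<le> A" using "0" [of "exp w"] by simp
    moreover have "cmod (C * of_real w) = A + cmod (e 0) + 1"
      using C w by (simp add: norm_mult) (simp add: w_def)
    ultimately show False using norm_triangle_ineq4 [of "C * of_real w + e 0" "e 0"] by simp
  qed
next
  case (Suc m)
  \<comment> \<open>\<open>f (2 * z) - 2 ^ Suc m * f z\<close> has no term of degree \<open>Suc m\<close> left.\<close>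
  define f where "f = (\<lambda>z. C * of_real (ln z) + (\<Sum>k\<le>Suc m. e k * of_real z ^ k))"
  define e' where "e' = (\<lambda>k. e k * (2 ^ k - 2 ^ Suc m) + (if k = 0 then C * of_real (ln 2) else 0))"
  have "C * (1 - 2 ^ Suc m) = 0"
  proof (rule Suc.IH)
    fix z :: real assume z: "z \<ge> 1"
    have s: "(\<Sum>k\<le>m. e' k * of_real z ^ k) =
        (\<Sum>k\<le>m. e k * (2 * of_real z) ^ k) - 2 ^ Suc m * (\<Sum>k\<le>m. e k * of_real z ^ k) + C * of_real (ln 2)"
    proof -
      have "(\<Sum>k\<le>m. e' k * of_real z ^ k) = (\<Sum>k\<le>m. e k * (2 * of_real z) ^ k - 2 ^ Suc m * (e k * of_real z ^ k)
          + (if k = 0 then C * of_real (ln 2) else 0))"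
        by (intro sum.cong) (auto simp: e'_def algebra_simps power_mult_distrib)
      then show ?thesis by (simp add: sum.distrib sum_subtractf sum_distrib_left)
    qed
    have "C * (1 - 2 ^ Suc m) * of_real (ln z) + (\<Sum>k\<le>m. e' k * of_real z ^ k) = f (2 * z) - 2 ^ Suc m * f z"
      using z unfolding s f_def
      by (simp add: ln_mult algebra_simps power_mult_distrib)
    also have "cmod \<dots> \<le> cmod (f (2 * z)) + cmod (2 ^ Suc m * f z)" by (rule norm_triangle_ineq4)
    also have "\<dots> \<le> A + 2 ^ Suc m * A"
    proof -
      have "cmod (f w) \<le> A" if "w \<ge> 1" for w unfolding f_def by (rule Suc.prems [OF that])
      then have "cmod (f (2 * z)) \<le> A" "cmod (f z) \<le> A" using z by simp_all
      then show ?thesis unfolding norm_mult norm_power norm_numeral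
        by (intro add_mono mult_left_mono) simp_all
    qed
    finally show "cmod (C * (1 - 2 ^ Suc m) * of_real (ln z) + (\<Sum>k\<le>m. e' k * of_real z ^ k)) \<le> A + 2 ^ Suc m * A" .
  qed
  moreover have "(2::complex) ^ Suc m \<noteq> 1"
  proof -
    have "cmod (2 ^ Suc m) > 1" unfolding norm_power by (rule one_less_power) auto
    then show ?thesis by (metis less_irrefl norm_one)
  qed
  ultimately show ?case by simp
qed

section \<open>The kernel as the real part of a resolvent\<close>

text \<open>Used for \<open>\<sigma> = \<i>\<close> and \<open>\<sigma> = - \<i>\<close>. The average of the two at \<open>n = 0\<close> is the kernel for \<open>x > 0\<close> and
\<open>t \<ge> 0\<close>, and the derivatives of resolvents are resolvents up to constants.\<close>

definition resolvent :: "nat \<Rightarrow> complex \<Rightarrow> real \<Rightarrow> real \<Rightarrow> complex" where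
  "resolvent n \<sigma> x t = 1 / (of_real t + \<sigma> * of_real x) ^ Suc n"

text \<open>Up to the sign \<open>(- 1) ^ k\<close>, this is the derivative of order \<open>k\<close> in \<open>x\<close> of the kernel, for \<open>x > 0\<close>
and \<open>t \<ge> 0\<close> (\<open>kernelP_resolvent\<close> is the case \<open>k = 0\<close>).\<close>

definition kernel_moment :: "nat \<Rightarrow> real \<Rightarrow> real \<Rightarrow> complex" where
  "kernel_moment k x t = fact k / 2 * (\<i> ^ k * resolvent k \<i> x t + (- \<i>) ^ k * resolvent k (- \<i>) x t)"

lemma resolvent_denominator:
  assumes "\<sigma> \<in> {\<i>, - \<i>}"
  shows "x \<noteq> 0 \<Longrightarrow> of_real t + \<sigma> * of_real x \<noteq> 0" and "\<bar>t\<bar> \<le> cmod (of_real t + \<sigma> * of_real x)"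
proof -
  have re: "Re (of_real t + \<sigma> * of_real x) = t" using assms by auto
  show "x \<noteq> 0 \<Longrightarrow> of_real t + \<sigma> * of_real x \<noteq> 0" using assms by (auto simp: complex_eq_iff)
  show "\<bar>t\<bar> \<le> cmod (of_real t + \<sigma> * of_real x)" using abs_Re_le_cmod re by metis
qed

lemma kernelP_resolvent:
  assumes "x > 0" "t \<ge> 0"
  shows "of_real (kernelP (x, t)) = kernel_moment 0 x t"
proof -
  have "of_real t + \<i> * of_real x \<noteq> 0" "of_real t - \<i> * of_real x \<noteq> 0"
    using resolvent_denominator(1) [of \<i> x t] resolvent_denominator(1) [of "- \<i>" x t] assms by auto
  moreover have "(of_real t + \<i> * of_real x) * (of_real t - \<i> * of_real x) = complex_of_real (x\<^sup>2 + t\<^sup>2)"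
    by (simp add: algebra_simps power2_eq_square)
  ultimately have "kernel_moment 0 x t = of_real t / of_real (x\<^sup>2 + t\<^sup>2)"
    by (simp add: kernel_moment_def resolvent_def add_frac_eq)
  then show ?thesis using assms by (simp add: kernelP_alt)
qed

lemma inverse_power_affine_deriv:
  fixes c d z :: complex
  assumes "c + d * z \<noteq> 0"
  shows "((\<lambda>z. 1 / (c + d * z) ^ Suc n) has_field_derivative
    - (of_nat (Suc n) * d * (1 / (c + d * z) ^ Suc (Suc n)))) (at z)"
proof -
  define w where "w = c + d * z"
  have "((\<lambda>z. (c + d * z) ^ Suc n) has_field_derivative of_nat (Suc n) * w ^ n * d) (at z)"
    unfolding w_def by (auto intro!: derivative_eq_intros simp del: power_Suc)
  from DERIV_inverse_fun [OF this] assms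
  have "((\<lambda>z. 1 / (c + d * z) ^ Suc n) has_field_derivative
      - (of_nat (Suc n) * w ^ n * d * inverse ((w ^ Suc n) ^ Suc (Suc 0)))) (at z)"
    by (simp add: w_def inverse_eq_divide)
  moreover have "of_nat (Suc n) * w ^ n * d * inverse ((w ^ Suc n) ^ Suc (Suc 0)) =
      of_nat (Suc n) * d * (1 / w ^ Suc (Suc n))"
    using assms unfolding w_def [symmetric] by (simp add: field_simps)
  ultimately show ?thesis by (simp only: w_def)
qed

lemma resolvent_continuous:
  assumes "\<sigma> \<in> {\<i>, - \<i>}" "continuous_on S u" "continuous_on S v" "\<And>z. z \<in> S \<Longrightarrow> u z > 0"
  shows "continuous_on S (\<lambda>z. resolvent n \<sigma> (u z) (v z))"
proof -
  have "(of_real (v z) + \<sigma> * of_real (u z)) ^ Suc n \<noteq> 0" if "z \<in> S" for z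
    using resolvent_denominator(1) [OF assms(1), of "u z" "v z"] assms(4) [OF that] by simp
  then show ?thesis unfolding resolvent_def by (intro continuous_intros assms(2,3) ballI)
qed

lemma kernel_moment_continuous:
  assumes "continuous_on S u" "continuous_on S v" "\<And>z. z \<in> S \<Longrightarrow> u z > 0"
  shows "continuous_on S (\<lambda>z. kernel_moment k (u z) (v z))"
  unfolding kernel_moment_def
  by (intro continuous_intros resolvent_continuous assms) auto

lemma resolvent_by_parts:
  assumes g: "derivative_tower g" and p: "0 < p" "p \<le> q" and ends: "\<And>n. g n p = 0" "\<And>n. g n q = 0"
    and \<sigma>: "\<sigma> \<in> {\<i>, - \<i>}"
  shows "integral {p..q} (\<lambda>x. of_real (g k x) * resolvent n \<sigma> x t) =
    (fact (n + k) / fact n) * \<sigma> ^ k * integral {p..q} (\<lambda>x. of_real (g 0 x) * resolvent (n + k) \<sigma> x t)"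
proof (induction k arbitrary: n)
  case (Suc k)
  have int: "(\<lambda>x. of_real (g j x) * resolvent n \<sigma> x t) integrable_on {p..q}" for j n
    by (rule integrable_continuous_real)
      (use p in \<open>auto intro!: continuous_intros resolvent_continuous \<sigma> tower_continuous_on [OF g]\<close>)
  have "((\<lambda>x. of_real (g (Suc k) x) * resolvent n \<sigma> x t
        - of_nat (Suc n) * \<sigma> * (of_real (g k x) * resolvent (Suc n) \<sigma> x t)) has_integral
        (of_real (g k q) * resolvent n \<sigma> q t - of_real (g k p) * resolvent n \<sigma> p t)) {p..q}"
  proof (rule fundamental_theorem_of_calculus [OF p(2)])
    fix x assume "x \<in> {p..q}"
    then have nz: "of_real t + \<sigma> * of_real x \<noteq> 0" using p \<sigma> resolvent_denominator(1) [OF \<sigma>, of x t] by auto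
    have 1: "((\<lambda>x. of_real (g k x)) has_vector_derivative complex_of_real (g (Suc k) x)) (at x)"
      using tower_deriv [OF g, of k x] by (rule has_vector_derivative_of_real)
    have 2: "((\<lambda>x. resolvent n \<sigma> x t) has_vector_derivative - (of_nat (Suc n) * \<sigma> * resolvent (Suc n) \<sigma> x t)) (at x)"
    proof -
      have "((\<lambda>z. 1 / (of_real t + \<sigma> * z) ^ Suc n) has_field_derivative
          - (of_nat (Suc n) * \<sigma> * (1 / (of_real t + \<sigma> * of_real x) ^ Suc (Suc n)))) (at (of_real x))"
        by (rule inverse_power_affine_deriv [OF nz])
      from has_vector_derivative_real_field [OF this] show ?thesis unfolding resolvent_def .
    qed
    from has_vector_derivative_mult [OF has_vector_derivative_at_within [OF 1, of "{p..q}"]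
        has_vector_derivative_at_within [OF 2, of "{p..q}"]]
    show "((\<lambda>x. of_real (g k x) * resolvent n \<sigma> x t) has_vector_derivative
        of_real (g (Suc k) x) * resolvent n \<sigma> x t
        - of_nat (Suc n) * \<sigma> * (of_real (g k x) * resolvent (Suc n) \<sigma> x t)) (at x within {p..q})"
      by (rule has_vector_derivative_eq_rhs) (simp add: algebra_simps)
  qed
  then have "integral {p..q} (\<lambda>x. of_real (g (Suc k) x) * resolvent n \<sigma> x t
        - of_nat (Suc n) * \<sigma> * (of_real (g k x) * resolvent (Suc n) \<sigma> x t)) = 0"
    by (simp add: ends integral_unique)
  then have "integral {p..q} (\<lambda>x. of_real (g (Suc k) x) * resolvent n \<sigma> x t)
      = of_nat (Suc n) * \<sigma> * integral {p..q} (\<lambda>x. of_real (g k x) * resolvent (Suc n) \<sigma> x t)"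
    by (subst (asm) integral_diff) (auto intro: int integrable_on_mult_right)
  also have "\<dots> = (fact (n + Suc k) / fact n) * \<sigma> ^ Suc k *
      integral {p..q} (\<lambda>x. of_real (g 0 x) * resolvent (n + Suc k) \<sigma> x t)"
  proof -
    have eq: "of_nat (Suc n) * (fact (Suc n + k) / fact (Suc n)) = (fact (n + Suc k) / fact n :: complex)"
      by (simp del: of_nat_Suc)
    show ?thesis unfolding Suc power_Suc eq [symmetric] by (simp only: add_Suc add_Suc_right mult_ac)
  qed
  finally show ?case .
qed simp

text \<open>All derivatives are moved from \<open>g\<close> to the kernel; there are no boundary terms as \<open>g\<close> and its
derivatives vanish at both ends.\<close>

lemma kernel_by_parts:
  assumes g: "derivative_tower g" and p: "0 < p" "p \<le> q" and ends: "\<And>n. g n p = 0" "\<And>n. g n q = 0"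
  shows "integral {p..q} (\<lambda>x. of_real (g k x) * kernel_moment 0 x t) =
    integral {p..q} (\<lambda>x. of_real (g 0 x) * kernel_moment k x t)"
proof -
  have int: "(\<lambda>x. of_real (g j x) * resolvent n \<sigma> x t) integrable_on {p..q}" if "\<sigma> \<in> {\<i>, - \<i>}" for j n \<sigma>
    by (rule integrable_continuous_real)
      (use p in \<open>auto intro!: continuous_intros resolvent_continuous that tower_continuous_on [OF g]\<close>)
  let ?I = "\<lambda>j n \<sigma>. integral {p..q} (\<lambda>x. of_real (g j x) * resolvent n \<sigma> x t)"
  have split: "integral {p..q} (\<lambda>x. of_real (g j x) * kernel_moment n x t)
      = fact n / 2 * (\<i> ^ n * ?I j n \<i> + (- \<i>) ^ n * ?I j n (- \<i>))" for j n
  proof -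
    have "integral {p..q} (\<lambda>x. of_real (g j x) * kernel_moment n x t) = integral {p..q}
      (\<lambda>x. fact n / 2 * \<i> ^ n * (of_real (g j x) * resolvent n \<i> x t)
         + fact n / 2 * (- \<i>) ^ n * (of_real (g j x) * resolvent n (- \<i>) x t))"
      by (simp add: kernel_moment_def algebra_simps)
    also have "\<dots> = fact n / 2 * \<i> ^ n * ?I j n \<i> + fact n / 2 * (- \<i>) ^ n * ?I j n (- \<i>)"
      by (subst integral_add) (auto intro!: integrable_on_mult_right int)
    finally show ?thesis by (simp add: algebra_simps)
  qed
  show ?thesis unfolding split
    using resolvent_by_parts [OF assms, of \<i> k 0 t] resolvent_by_parts [OF assms, of "- \<i>" k 0 t]
    by (simp add: algebra_simps)
qed

text \<open>The singular part, as \<open>x\<close> decreases to 0, of the integral of \<open>kernel_moment k x\<close> over \<open>{0..1}\<close>.\<close>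

definition leading_part :: "nat \<Rightarrow> real \<Rightarrow> real" where
  "leading_part k x = (if k = 0 then - ln x else fact (k - 1) / x ^ k)"

text \<open>The antiderivatives in \<open>t\<close> are \<open>ln (x\<^sup>2 + t\<^sup>2) / 2\<close> for \<open>k = 0\<close> and resolvents of order one less
otherwise. Their values at \<open>t = 0\<close> give the leading part, those at \<open>t = 1\<close> stay bounded.\<close>

lemma kernel_moment_initial_integral:
  assumes x: "0 < x" "x \<le> 2"
  shows "cmod (integral {0..1} (kernel_moment k x) - of_real (leading_part k x)) \<le> 2 * fact k"
proof (cases k)
  case 0
  have pos: "x\<^sup>2 + t\<^sup>2 > 0" for t using x by (simp add: add_pos_nonneg)
  have "((\<lambda>t. kernelP (x, t)) has_integral (ln (x\<^sup>2 + 1\<^sup>2) / 2 - ln (x\<^sup>2 + 0\<^sup>2) / 2)) {0..1}"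
  proof (rule fundamental_theorem_of_calculus)
    fix t :: real assume "t \<in> {0..1}"
    then have "kernelP (x, t) = t / (x\<^sup>2 + t\<^sup>2)" by (auto simp: kernelP_alt)
    moreover have "1 / D * (2 * t) / 2 = t / D" for D :: real by simp
    ultimately have "1 / (x\<^sup>2 + t\<^sup>2) * (2 * t) / 2 = kernelP (x, t)" by (simp only:)
    moreover have "((\<lambda>t. ln (x\<^sup>2 + t\<^sup>2) / 2) has_real_derivative 1 / (x\<^sup>2 + t\<^sup>2) * (2 * t) / 2) (at t within {0..1})"
      using pos [of t]
      by (intro DERIV_cdivide DERIV_chain2 [OF DERIV_ln_divide]) (auto intro!: derivative_eq_intros)
    ultimately show "((\<lambda>t. ln (x\<^sup>2 + t\<^sup>2) / 2) has_vector_derivative kernelP (x, t)) (at t within {0..1})"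
      by (simp only: has_real_derivative_iff_has_vector_derivative)
  qed simp
  then have "((\<lambda>t. kernelP (x, t)) has_integral (ln (x\<^sup>2 + 1) / 2 - ln x)) {0..1}"
    using x by (simp add: ln_realpow)
  then have "((\<lambda>t. complex_of_real (kernelP (x, t))) has_integral of_real (ln (x\<^sup>2 + 1) / 2 - ln x)) {0..1}"
    by (rule has_integral_of_real)
  then have "(kernel_moment 0 x has_integral of_real (ln (x\<^sup>2 + 1) / 2 - ln x)) {0..1}"
    by (rule has_integral_eq [rotated]) (use x kernelP_resolvent in auto)
  then have "integral {0..1} (kernel_moment k x) - of_real (leading_part k x) = of_real (ln (x\<^sup>2 + 1) / 2)"
    using 0 by (simp add: integral_unique leading_part_def)
  moreover have "0 \<le> ln (x\<^sup>2 + 1)" "ln (x\<^sup>2 + 1) \<le> 4"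
  proof -
    show "0 \<le> ln (x\<^sup>2 + 1)" by (simp add: ln_ge_zero)
    have "ln (1 + x\<^sup>2) \<le> x\<^sup>2" by (rule ln_add_one_self_le_self) simp
    also have "x\<^sup>2 \<le> 2\<^sup>2" using x by (intro power_mono) auto
    finally show "ln (x\<^sup>2 + 1) \<le> 4" by (simp add: add.commute)
  qed
  ultimately show ?thesis using 0 by (simp only: norm_of_real) simp
next
  case (Suc j)
  have res: "(resolvent (Suc j) \<sigma> x has_integral (resolvent j \<sigma> x 0 - resolvent j \<sigma> x 1) / of_nat (Suc j)) {0..1}"
    if \<sigma>: "\<sigma> \<in> {\<i>, - \<i>}" for \<sigma>
  proof -
    have "(resolvent (Suc j) \<sigma> x has_integral (- (1 / of_nat (Suc j)) * resolvent j \<sigma> x 1 - - (1 / of_nat (Suc j)) * resolvent j \<sigma> x 0)) {0..1}"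
    proof (rule fundamental_theorem_of_calculus)
      fix t :: real
      have "\<sigma> * of_real x + 1 * of_real t \<noteq> 0"
        using resolvent_denominator(1) [OF \<sigma>, of x t] x by (simp add: add.commute)
      from inverse_power_affine_deriv [OF this, of j]
      have "((\<lambda>z. 1 / (z + \<sigma> * of_real x) ^ Suc j) has_field_derivative
          - (of_nat (Suc j) * (1 / (of_real t + \<sigma> * of_real x) ^ Suc (Suc j)))) (at (of_real t))"
        by (simp add: add.commute)
      from DERIV_cmult [OF this, of "- (1 / of_nat (Suc j))"]
      have "((\<lambda>z. - (1 / of_nat (Suc j)) * (1 / (z + \<sigma> * of_real x) ^ Suc j)) has_field_derivative
          1 / (of_real t + \<sigma> * of_real x) ^ Suc (Suc j)) (at (of_real t))"
        by (simp del: of_nat_Suc power_Suc)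
      from has_vector_derivative_real_field [OF this]
      show "((\<lambda>t. - (1 / of_nat (Suc j)) * resolvent j \<sigma> x t) has_vector_derivative resolvent (Suc j) \<sigma> x t) (at t within {0..1})"
        unfolding resolvent_def by (rule has_vector_derivative_at_within)
    qed simp
    then show ?thesis by (rule has_integral_eq_rhs) (simp add: diff_divide_distrib)
  qed
  let ?R = "\<lambda>\<sigma>. \<sigma> ^ k * ((resolvent j \<sigma> x 0 - resolvent j \<sigma> x 1) / of_nat (Suc j))"
  have "(kernel_moment k x has_integral (fact k / 2 * (?R \<i> + ?R (- \<i>)))) {0..1}"
    unfolding kernel_moment_def [abs_def] Suc
    by (intro has_integral_mult_right has_integral_add res) auto
  then have "integral {0..1} (kernel_moment k x) = fact k / 2 * (?R \<i> + ?R (- \<i>))" by (rule integral_unique)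
  also have "\<dots> = fact j * ((\<i> ^ k * resolvent j \<i> x 0 + (- \<i>) ^ k * resolvent j (- \<i>) x 0) / 2
      - (\<i> ^ k * resolvent j \<i> x 1 + (- \<i>) ^ k * resolvent j (- \<i>) x 1) / 2)"
  proof -
    have "(of_nat (Suc j) * F) / 2 * (s * (a / of_nat (Suc j)) + s' * (a' / of_nat (Suc j))) = F * ((s * a + s' * a') / 2)"
      for F s s' a a' :: complex
      by (simp add: field_simps del: of_nat_Suc)
    then show ?thesis unfolding Suc fact_Suc by (simp add: algebra_simps diff_divide_distrib add_divide_distrib del: of_nat_Suc)
  qed
  also have "(\<i> ^ k * resolvent j \<i> x 0 + (- \<i>) ^ k * resolvent j (- \<i>) x 0) / 2 = 1 / of_real x ^ k"
  proof -
    have "\<sigma> ^ k * resolvent j \<sigma> x 0 = 1 / of_real x ^ k" if "\<sigma> \<in> {\<i>, - \<i>}" for \<sigma>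
    proof -
      have "\<sigma> \<noteq> 0" using that by auto
      then show ?thesis unfolding resolvent_def Suc by (simp add: power_mult_distrib del: power_Suc)
    qed
    then show ?thesis by simp
  qed
  finally have "integral {0..1} (kernel_moment k x) - of_real (leading_part k x)
      = - (fact j * ((\<i> ^ k * resolvent j \<i> x 1 + (- \<i>) ^ k * resolvent j (- \<i>) x 1) / 2))"
    by (simp add: leading_part_def Suc algebra_simps)
  then have "cmod (integral {0..1} (kernel_moment k x) - of_real (leading_part k x))
      = fact j * (cmod (\<i> ^ k * resolvent j \<i> x 1 + (- \<i>) ^ k * resolvent j (- \<i>) x 1) / 2)"
    by (simp add: norm_mult norm_divide)
  also have "\<dots> \<le> fact j * ((1 + 1) / 2)"
  proof -
    have "cmod (\<sigma> ^ k * resolvent j \<sigma> x 1) \<le> 1" if \<sigma>: "\<sigma> \<in> {\<i>, - \<i>}" for \<sigma>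
    proof -
      have "cmod \<sigma> = 1" using \<sigma> by auto
      moreover have "1 \<le> cmod (of_real 1 + \<sigma> * of_real x) ^ Suc j"
        using resolvent_denominator(2) [OF \<sigma>, of 1 x] by (intro one_le_power) simp
      ultimately show ?thesis
        unfolding resolvent_def norm_mult norm_power norm_divide by (simp add: divide_le_eq_1 del: power_Suc)
    qed
    then show ?thesis
      by (intro mult_left_mono divide_right_mono norm_triangle_le add_mono) auto
  qed
  also have "\<dots> \<le> 2 * fact k"
  proof -
    have "(fact j :: real) \<le> fact k" unfolding Suc by (rule fact_mono) simp
    moreover have "(fact k :: real) \<ge> 0" by simp
    ultimately have "(fact j :: real) \<le> 2 * fact k" by linarith
    then show ?thesis by simp
  qed
  finally show ?thesis .
qed

lemma kernel_moment_late:
  assumes "0 < x" "1 \<le> t"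
  shows "cmod (kernel_moment k x t) \<le> fact k"
proof -
  have "cmod (\<sigma> ^ k * resolvent k \<sigma> x t) \<le> 1" if \<sigma>: "\<sigma> \<in> {\<i>, - \<i>}" for \<sigma>
  proof -
    have "cmod \<sigma> = 1" using \<sigma> by auto
    moreover have "1 \<le> cmod (of_real t + \<sigma> * of_real x) ^ Suc k"
      using resolvent_denominator(2) [OF \<sigma>, of t x] assms by (intro one_le_power) simp
    ultimately show ?thesis
      unfolding resolvent_def norm_mult norm_power norm_divide by (simp add: divide_le_eq_1 del: power_Suc)
  qed
  then have "cmod (\<i> ^ k * resolvent k \<i> x t + (- \<i>) ^ k * resolvent k (- \<i>) x t) \<le> 1 + 1"
    by (intro norm_triangle_le add_mono) auto
  then show ?thesis by (simp add: kernel_moment_def norm_mult norm_divide)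
qed

text \<open>The singularity of the kernel at \<open>x = 0\<close> is only felt for small \<open>t\<close>, where the weight is constant.\<close>

lemma weighted_kernel_moment:
  assumes \<alpha>: "continuous_on UNIV \<alpha>" "\<And>t. 0 \<le> t \<Longrightarrow> t \<le> 1 \<Longrightarrow> \<alpha> t = \<alpha> 0" "\<And>t. cmod (\<alpha> t) \<le> M"
    and T: "1 \<le> T" and x: "0 < x" "x \<le> 2"
  shows "cmod (integral {0..T} (\<lambda>t. \<alpha> t * kernel_moment k x t) - \<alpha> 0 * of_real (leading_part k x))
    \<le> M * (2 * fact k) + M * fact k * (T - 1)"
proof -
  have M: "M \<ge> 0" by (rule order_trans [OF norm_ge_zero \<alpha>(3)])
  have cont: "continuous_on S (\<lambda>t. \<alpha> t * kernel_moment k x t)" for S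
    using x by (intro continuous_intros kernel_moment_continuous continuous_on_subset [OF \<alpha>(1)]) auto
  have "integral {0..T} (\<lambda>t. \<alpha> t * kernel_moment k x t)
      = integral {0..1} (\<lambda>t. \<alpha> t * kernel_moment k x t) + integral {1..T} (\<lambda>t. \<alpha> t * kernel_moment k x t)"
    using T by (intro Henstock_Kurzweil_Integration.integral_combine [symmetric] integrable_continuous_real cont) auto
  also have "integral {0..1} (\<lambda>t. \<alpha> t * kernel_moment k x t) = \<alpha> 0 * integral {0..1} (kernel_moment k x)"
  proof -
    have "integral {0..1} (\<lambda>t. \<alpha> t * kernel_moment k x t) = integral {0..1} (\<lambda>t. \<alpha> 0 * kernel_moment k x t)"
    proof (rule integral_cong)
      fix t :: real assume "t \<in> {0..1}"
      then have "\<alpha> t = \<alpha> 0" by (intro \<alpha>(2)) auto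
      then show "\<alpha> t * kernel_moment k x t = \<alpha> 0 * kernel_moment k x t" by (simp only:)
    qed
    then show ?thesis by simp
  qed
  finally have "integral {0..T} (\<lambda>t. \<alpha> t * kernel_moment k x t) - \<alpha> 0 * of_real (leading_part k x)
      = \<alpha> 0 * (integral {0..1} (kernel_moment k x) - of_real (leading_part k x))
        + integral {1..T} (\<lambda>t. \<alpha> t * kernel_moment k x t)"
    by (simp add: algebra_simps)
  also have "cmod \<dots> \<le> M * (2 * fact k) + M * fact k * (T - 1)"
  proof (intro norm_triangle_le add_mono)
    show "cmod (\<alpha> 0 * (integral {0..1} (kernel_moment k x) - of_real (leading_part k x))) \<le> M * (2 * fact k)"
      unfolding norm_mult by (intro mult_mono \<alpha>(3) kernel_moment_initial_integral x M) simp
    show "cmod (integral {1..T} (\<lambda>t. \<alpha> t * kernel_moment k x t)) \<le> M * fact k * (T - 1)"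
    proof (rule integral_bound [OF T cont])
      fix t assume "t \<in> {1..T}"
      then show "cmod (\<alpha> t * kernel_moment k x t) \<le> M * fact k"
        unfolding norm_mult using x by (intro mult_mono \<alpha>(3) kernel_moment_late M) auto
    qed
  qed
  finally show ?thesis .
qed

text \<open>For \<open>g\<close> supported away from \<open>x = 0\<close> the integrand is continuous on a compact box, so the integrals
in \<open>x\<close> and \<open>t\<close> may be exchanged. The exchange is made twice: once to integrate by parts in \<open>x\<close> for
fixed \<open>t\<close>, and back to integrate in \<open>t\<close> for fixed \<open>x\<close>.\<close>

lemma kernel_box_integral:
  fixes m :: nat
  assumes g: "derivative_tower g" and p: "0 < p" "p \<le> q"
    and out: "\<And>n x. x \<notin> {p<..<q} \<Longrightarrow> g n x = 0"
    and \<alpha>: "\<And>k. continuous_on UNIV (\<alpha> k)" "\<And>k t. t \<ge> T \<Longrightarrow> \<alpha> k t = 0"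
  defines "H \<equiv> \<lambda>x. \<Sum>k\<le>m. integral {0..T} (\<lambda>t. \<alpha> k t * kernel_moment k x t)"
  shows "(LINT z|lborel. of_real (kernelP z) * (\<Sum>k\<le>m. of_real (g k (fst z)) * \<alpha> k (snd z)))
      = integral {p..q} (\<lambda>x. of_real (g 0 x) * H x)"
    and "(\<lambda>x. of_real (g 0 x) * H x) integrable_on {p..q}"
proof -
  define f where "f = (\<lambda>x t. \<Sum>k\<le>m. \<alpha> k t * (of_real (g k x) * kernel_moment 0 x t))"
  define f' where "f' = (\<lambda>x t. \<Sum>k\<le>m. \<alpha> k t * (of_real (g 0 x) * kernel_moment k x t))"
  let ?B = "cbox (p, 0) (q, T)"
  have pos: "fst z > 0" if "z \<in> ?B" for z using that p by (auto simp: cbox_Pair_eq)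
  have cont1: "continuous_on S (\<lambda>z. of_real (g k (fst z)) :: complex)" for k and S :: "(real \<times> real) set"
    by (rule continuous_on_of_real, rule continuous_on_compose2 [OF tower_continuous_on [OF g, of UNIV]])
       (auto intro: continuous_intros)
  have cont2: "continuous_on S (\<lambda>z. \<alpha> k (snd z))" for k and S :: "(real \<times> real) set"
    by (rule continuous_on_compose2 [OF \<alpha>(1)]) (auto intro: continuous_intros)
  have cont3: "continuous_on ?B (\<lambda>z. kernel_moment k (fst z) (snd z))" for k
    by (rule kernel_moment_continuous) (auto intro: continuous_intros pos)
  have f: "continuous_on ?B (\<lambda>(x, t). f x t)" and f': "continuous_on ?B (\<lambda>(x, t). f' x t)"
    unfolding f_def f'_def case_prod_beta by (intro continuous_intros cont1 cont2 cont3)+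
  have eq: "integral (cbox 0 T) (f' x) = of_real (g 0 x) * H x" if "x \<in> cbox p q" for x
  proof -
    have int: "(\<lambda>t. \<alpha> k t * kernel_moment k x t) integrable_on {0..T}" for k
      by (intro integrable_continuous_real continuous_intros kernel_moment_continuous continuous_on_subset [OF \<alpha>(1)])
         (use that p in auto)
    have "f' x = (\<lambda>t. of_real (g 0 x) * (\<Sum>k\<le>m. \<alpha> k t * kernel_moment k x t))"
      by (simp add: f'_def fun_eq_iff sum_distrib_left mult_ac)
    then show ?thesis unfolding H_def by (simp add: integral_sum int)
  qed
  have "of_real (kernelP z) * (\<Sum>k\<le>m. of_real (g k (fst z)) * \<alpha> k (snd z))
      = indicator ?B z *\<^sub>R (case z of (x, t) \<Rightarrow> f x t)" for z
  proof (cases "z \<in> ?B")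
    case True
    then have "of_real (kernelP z) = kernel_moment 0 (fst z) (snd z)"
      using kernelP_resolvent [of "fst z" "snd z"] pos [OF True] by (auto simp: cbox_Pair_eq)
    then show ?thesis using True by (simp add: f_def case_prod_beta sum_distrib_left mult_ac)
  next
    case False
    then consider "fst z \<notin> {p<..<q}" | "snd z \<le> 0" | "snd z \<ge> T" by (fastforce simp: cbox_Pair_eq mem_Times_iff)
    then have "of_real (kernelP z) * (\<Sum>k\<le>m. of_real (g k (fst z)) * \<alpha> k (snd z)) = 0"
      by cases (simp_all add: out \<alpha>(2) kernelP_alt)
    then show ?thesis using False by simp
  qed
  then have "(LINT z|lborel. of_real (kernelP z) * (\<Sum>k\<le>m. of_real (g k (fst z)) * \<alpha> k (snd z)))
      = (LINT z:?B|lborel. (case z of (x, t) \<Rightarrow> f x t))"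
    by (simp add: set_lebesgue_integral_def)
  also have "\<dots> = integral ?B (\<lambda>(x, t). f x t)"
    by (rule set_borel_integral_eq_integral(2))
       (use borel_integrable_compact [OF compact_cbox f] in \<open>simp add: set_integrable_def\<close>)
  also have "\<dots> = integral (cbox p q) (\<lambda>x. integral (cbox 0 T) (f x))"
    using integral_prod_continuous [OF f] by simp
  also have "\<dots> = integral (cbox 0 T) (\<lambda>t. integral (cbox p q) (\<lambda>x. f x t))"
    by (rule integral_swap_continuous [OF f])
  also have "\<dots> = integral (cbox 0 T) (\<lambda>t. integral (cbox p q) (\<lambda>x. f' x t))"
  proof (rule integral_cong)
    fix t
    have int: "(\<lambda>x. of_real (g k x) * kernel_moment j x t) integrable_on {p..q}" for k j
      by (intro integrable_continuous_real continuous_intros kernel_moment_continuous tower_continuous_on [OF g])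
         (use p in auto)
    have "integral {p..q} (\<lambda>x. f x t) = (\<Sum>k\<le>m. \<alpha> k t * integral {p..q} (\<lambda>x. of_real (g k x) * kernel_moment 0 x t))"
      unfolding f_def by (subst integral_sum) (auto intro: integrable_on_mult_right int)
    also have "\<dots> = (\<Sum>k\<le>m. \<alpha> k t * integral {p..q} (\<lambda>x. of_real (g 0 x) * kernel_moment k x t))"
      by (simp add: kernel_by_parts [OF g p] out)
    also have "\<dots> = integral {p..q} (\<lambda>x. f' x t)"
      unfolding f'_def by (subst integral_sum) (auto intro: integrable_on_mult_right int)
    finally show "integral (cbox p q) (\<lambda>x. f x t) = integral (cbox p q) (\<lambda>x. f' x t)" by simp
  qed
  also have "\<dots> = integral (cbox p q) (\<lambda>x. integral (cbox 0 T) (f' x))"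
    by (rule integral_swap_continuous [OF f', symmetric])
  also have "\<dots> = integral (cbox p q) (\<lambda>x. of_real (g 0 x) * H x)"
    by (rule integral_cong) (rule eq)
  also have "\<dots> = integral {p..q} (\<lambda>x. of_real (g 0 x) * H x)" by simp
  finally show "(LINT z|lborel. of_real (kernelP z) * (\<Sum>k\<le>m. of_real (g k (fst z)) * \<alpha> k (snd z)))
      = integral {p..q} (\<lambda>x. of_real (g 0 x) * H x)" .
  have "(\<lambda>x. integral (cbox 0 T) (f' x)) integrable_on cbox p q"
    using integral_integrable_2dim [OF f'] by simp
  then have "(\<lambda>x. of_real (g 0 x) * H x) integrable_on cbox p q"
    by (rule integrable_eq) (rule eq)
  then show "(\<lambda>x. of_real (g 0 x) * H x) integrable_on {p..q}" by simp
qed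

text \<open>Duality between \<open>L\<^sup>\<infinity>\<close> and \<open>L\<^sup>1\<close>, with the \<open>L\<^sup>1\<close> norm of \<open>\<phi>\<close> estimated by the measure of a set.\<close>

lemma Linf_dual_bound:
  assumes "Linf_norm_le u 1" "test_function \<phi>"
    and "S \<in> sets lborel" "emeasure lborel S < \<infinity>" "\<And>x. cmod (\<phi> x) \<le> indicator S x"
  shows "cmod (u \<phi>) \<le> measure lborel S"
proof -
  obtain f where f: "f \<in> borel_measurable lborel" "AE x in lborel. cmod (f x) \<le> 1"
    and "\<forall>\<phi>. test_function \<phi> \<longrightarrow> u \<phi> = dist_of_fun f \<phi>"
    using assms(1) unfolding Linf_norm_le_def by blast
  then have u: "u \<phi> = dist_of_fun f \<phi>" using assms(2) by simp
  have S: "integrable lborel (indicat_real S)" using assms(3,4) by (intro integrable_real_indicator) auto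
  have AE: "AE x in lborel. cmod (f x * \<phi> x) \<le> indicator S x"
    using f(2)
  proof (eventually_elim)
    case (elim x)
    then have "cmod (f x) * cmod (\<phi> x) \<le> 1 * indicator S x" by (intro mult_mono assms(5)) auto
    then show ?case by (simp add: norm_mult)
  qed
  have [measurable]: "\<phi> \<in> borel_measurable borel" by (rule test_function_measurable [OF assms(2)])
  have int: "integrable lborel (\<lambda>x. f x * \<phi> x)"
  proof (rule Bochner_Integration.integrable_bound [OF S])
    show "(\<lambda>x. f x * \<phi> x) \<in> borel_measurable lborel" using f(1) by measurable
    show "AE x in lborel. norm (f x * \<phi> x) \<le> norm (indicat_real S x)" using AE by simp
  qed
  have "cmod (u \<phi>) \<le> (LINT x|lborel. cmod (f x * \<phi> x))"
    unfolding u dist_of_fun_def by (rule integral_norm_bound)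
  also have "\<dots> \<le> (LINT x|lborel. indicator S x)"
    by (rule integral_mono_AE [OF integrable_norm [OF int] S AE])
  finally show ?thesis using assms(3) by simp
qed

section \<open>The vertical segment carries no charge\<close>

lemma leading_part_scale:
  assumes "0 < u" "0 < z"
  shows "leading_part k (u / z) = leading_part k u * z ^ k + (if k = 0 then ln z else 0)"
  using assms by (simp add: leading_part_def ln_div power_divide)

text \<open>The potential is tested with \<open>g\<close> rescaled to \<open>{1 / z..2 / z}\<close>. Boundedness of the potential makes the
result \<open>O(1 / z)\<close>, whereas its expansion contains the charge of \<open>\<nu>\<close> times \<open>ln z / z\<close>.\<close>

lemma vertical_segment_no_charge:
  assumes adm: "admissible ({0} \<times> {0..L}) \<nu>" and L: "0 < L"
  shows "dist_pairing \<nu> (\<lambda>_. 1) = 0"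
proof -
  have \<nu>: "distribution \<nu>" and supp: "dist_support \<nu> \<subseteq> {0} \<times> {0..L}"
    and Linf: "Linf_norm_le (dist_conv (dist_of_fun (\<lambda>p. complex_of_real (kernelP p))) \<nu>) 1"
    using adm by (auto simp: admissible_def)
  obtain C m where C: "0 < C" "tensor_order \<nu> C m"
    using tensor_order_near_segment [OF \<nu> supp] by metis
  obtain \<theta> where \<theta>: "derivative_tower \<theta>" "\<And>x. x \<in> {0 - 1..0 + 1} \<Longrightarrow> \<theta> 0 x = 1"
      "\<And>x. x \<notin> {0 - 2 * 1..0 + 2 * 1} \<Longrightarrow> \<theta> 0 x = 0"
    using smooth_plateau [of 1 0 0] by (metis zero_less_one)
  obtain a where a: "derivative_tower a" "\<And>x. 0 \<le> a 0 x" "\<And>x. a 0 x \<le> 1"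
      "\<And>x. x \<in> {0 - 1..(L + 1) + 1} \<Longrightarrow> a 0 x = 1"
      "\<And>x. x \<notin> {0 - 2 * 1..(L + 1) + 2 * 1} \<Longrightarrow> a 0 x = 0"
    using smooth_plateau [of 1 0 "L + 1"] by (metis zero_less_one)
  \<comment> \<open>The support of \<open>g\<close> stays away from 0, where the kernel is singular, and lies strictly inside
    \<open>{1..2}\<close>, so that all boundary terms at 1 and 2 vanish.\<close>
  obtain g where g: "derivative_tower g" "\<And>x. 0 \<le> g 0 x" "\<And>x. g 0 x \<le> 1"
      "\<And>x. x \<in> {3/2 - 1/8..3/2 + 1/8} \<Longrightarrow> g 0 x = 1"
      "\<And>x. x \<notin> {3/2 - 2 * (1/8)..3/2 + 2 * (1/8)} \<Longrightarrow> g 0 x = 0"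
    using smooth_plateau [of "1/8" "3/2" "3/2"] by (metis zero_less_divide_1_iff zero_less_numeral)
  have \<theta>1: "\<theta> 0 x = 1" if "x \<in> {-1..1}" for x by (rule \<theta>(2)) (use that in auto)
  have \<theta>0: "\<theta> 0 x = 0" if "x \<notin> {-2..2}" for x by (rule \<theta>(3)) (use that in auto)
  have a1: "a 0 x = 1" if "x \<in> {-1..L + 2}" for x by (rule a(4)) (use that in auto)
  have a0: "a 0 x = 0" if "x \<notin> {-2..L + 3}" for x by (rule a(5)) (use that in auto)
  have g_out: "g 0 x = 0" if "x \<notin> {5/4..7/4}" for x by (rule g(5)) (use that in auto)
  have g_tail: "g n x = 0" if "x \<in> - {5/4..7/4}" for n x
  proof (rule tower_vanishes [OF g(1) _ _ that])
    show "open (- {5/4..7/4 :: real})" by (intro open_Compl closed_atLeastAtMost)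
    show "g 0 y = 0" if "y \<in> - {5/4..7/4}" for y by (rule g_out) (use that in auto)
  qed
  define \<alpha> where "\<alpha> = transversal_moment \<nu> \<theta> a"
  have expansion: "\<nu> (\<lambda>q. tensor h a ((x, t) + q)) = (\<Sum>k\<le>m. of_real (h k x) * \<alpha> k t)"
    if "derivative_tower h" "\<And>x. x \<notin> {c..d} \<Longrightarrow> h 0 x = 0" for h c d x t
    unfolding \<alpha>_def by (rule transversal_expansion) (fact \<nu> supp \<theta>(1) \<theta>1 \<theta>0 a(1) a1 a0 C(2) that)+
  have early: "\<alpha> k t = \<alpha> k 0" if "0 \<le> t" "t \<le> 1" for k t
    unfolding \<alpha>_def by (rule transversal_moment_early) (fact \<nu> supp \<theta>(1) \<theta>1 \<theta>0 a(1) a1 a0 that)+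
  have late: "\<alpha> k t = 0" if "t \<ge> L + 4" for k t
    unfolding \<alpha>_def by (rule transversal_moment_late) (fact \<nu> supp \<theta>(1) \<theta>1 \<theta>0 a(1) a1 a0 that)+
  have cont: "continuous_on UNIV (\<alpha> k)" for k
    unfolding \<alpha>_def by (rule transversal_moment_continuous) (fact \<nu> supp \<theta>(1) \<theta>1 \<theta>0 a(1) a1 a0 C)+
  have "\<exists>M. \<forall>t. cmod (\<alpha> k t) \<le> M" for k
    unfolding \<alpha>_def
    using transversal_moment_bounded [OF \<nu> supp \<theta>(1) \<theta>1 \<theta>0 a(1) a1 a0 C(2)] by metis
  then obtain M where M: "\<And>k t. cmod (\<alpha> k t) \<le> M k" by metis
  have charge: "dist_pairing \<nu> (\<lambda>_. 1) = \<alpha> 0 0"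
    unfolding \<alpha>_def by (rule transversal_moment_zero) (fact \<nu> supp \<theta>(1) \<theta>1 \<theta>0 a(1) a1 a0)+

  \<comment> \<open>After time \<open>T\<close> the translated profile \<open>a (t + \<cdot>)\<close> has left the segment.\<close>
  define T where "T = L + 4"
  define H where "H = (\<lambda>x. \<Sum>k\<le>m. integral {0..T} (\<lambda>t. \<alpha> k t * kernel_moment k x t))"
  define E where "E = (\<Sum>k\<le>m. M k * (2 * fact k) + M k * fact k * (T - 1))"
  have H: "cmod (H x - (\<Sum>k\<le>m. \<alpha> k 0 * of_real (leading_part k x))) \<le> E" if "0 < x" "x \<le> 2" for x
    unfolding H_def E_def sum_subtractf [symmetric]
  proof (rule sum_norm_le)
    fix k
    show "cmod (integral {0..T} (\<lambda>t. \<alpha> k t * kernel_moment k x t) - \<alpha> k 0 * of_real (leading_part k x))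
        \<le> M k * (2 * fact k) + M k * fact k * (T - 1)"
      by (rule weighted_kernel_moment [OF cont early M]) (use L that in \<open>auto simp: T_def\<close>)
  qed

  \<comment> \<open>Moments of the fixed profile \<open>g\<close>; rescaling \<open>g\<close> to \<open>{1 / z..2 / z}\<close> multiplies them by powers
    of \<open>z\<close>, except that the logarithm contributes an additional \<open>ln z\<close>.\<close>
  define G where "G = integral {1..2} (g 0)"
  define F where "F = (\<lambda>k. integral {1..2} (\<lambda>u. g 0 u * leading_part k u))"
  have lead_cont: "continuous_on {1..2} (\<lambda>u. g 0 u * leading_part k u)" for k
    unfolding leading_part_def
    by (cases "k = 0") (auto intro!: continuous_intros tower_continuous_on [OF g(1)])
  have "cmod (\<alpha> 0 0 * of_real G * of_real (ln z) + (\<Sum>k\<le>m. \<alpha> k 0 * of_real (F k) * of_real z ^ k)) \<le> (L + 5) + E"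
    if z: "z \<ge> 1" for z
  proof -
    define h where "h = (\<lambda>n x. z ^ n * g n (z * x + 0))"
    define p where "p = 1 / z"
    define q where "q = 2 / z"
    have p: "0 < p" "p \<le> q" and q: "q \<le> 2" using z by (auto simp: p_def q_def field_simps)
    have h: "derivative_tower h" unfolding h_def by (rule derivative_tower_affine [OF g(1)])
    have h_le: "0 \<le> h 0 x" "h 0 x \<le> 1" for x by (simp_all add: h_def g)
    have h_out: "h n x = 0" if "x \<notin> {p<..<q}" for n x
    proof -
      have "z * x + 0 \<in> - {5/4..7/4}" using that z by (auto simp: p_def q_def field_simps)
      then have "g n (z * x + 0) = 0" by (rule g_tail)
      then show ?thesis by (simp add: h_def)
    qed
    have h0: "h 0 x = 0" if "x \<notin> {p..q}" for x by (rule h_out) (use that in auto)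
    let ?u = "dist_conv (dist_of_fun (\<lambda>p. complex_of_real (kernelP p))) \<nu> (tensor h a)"
    let ?l = "\<lambda>x. \<Sum>k\<le>m. \<alpha> k 0 * of_real (leading_part k x)"
    have late': "\<alpha> k t = 0" if "t \<ge> T" for k t using late that by (simp add: T_def)
    have "?u = (LINT w|lborel. of_real (kernelP w) * (\<Sum>k\<le>m. of_real (h k (fst w)) * \<alpha> k (snd w)))"
    proof -
      have "\<nu> (\<lambda>q. tensor h a (w + q)) = (\<Sum>k\<le>m. of_real (h k (fst w)) * \<alpha> k (snd w))" for w
        using expansion [where c = p and d = q, OF h h0, of "fst w" "snd w"] by simp
      then show ?thesis unfolding dist_conv_def dist_of_fun_def by simp
    qed
    also have "\<dots> = integral {p..q} (\<lambda>x. of_real (h 0 x) * H x)"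
      unfolding H_def by (rule kernel_box_integral(1)) (fact h p h_out cont late')+
    finally have u: "?u = integral {p..q} (\<lambda>x. of_real (h 0 x) * H x)" .
    have hH: "(\<lambda>x. of_real (h 0 x) * H x) integrable_on {p..q}"
      unfolding H_def by (rule kernel_box_integral(2)) (fact h p h_out cont late')+
    \<comment> \<open>The test function is bounded by 1 and lives on a box of width \<open>1 / z\<close>.\<close>
    have u_le: "cmod ?u \<le> (L + 5) / z"
    proof -
      let ?S = "cbox (p, -2) (q, L + 3)"
      have "cmod ?u \<le> measure lborel ?S"
      proof (rule Linf_dual_bound [OF Linf])
        show "test_function (tensor h a)" by (rule test_function_tensor) (fact h a(1) h0 a0)+
        show "emeasure lborel ?S < \<infinity>" by (rule emeasure_lborel_cbox_finite)
        fix w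
        show "cmod (tensor h a w) \<le> indicator ?S w"
        proof (cases "w \<in> ?S")
          case True
          then show ?thesis using h_le [of "fst w"] a(2,3) [of "snd w"]
            by (simp add: tensor_def norm_mult mult_le_one flip: of_real_mult)
        next
          case False
          then have w: "w \<notin> {p..q} \<times> {-2..L + 3}" by (simp add: cbox_Pair_eq)
          have "tensor h a w = 0"
            by (rule tensor_outside [where A = "{p..q}" and B = "{-2..L + 3}"]) (fact h0 a0 w)+
          then show ?thesis by simp
        qed
      qed simp
      also have "\<dots> = (q - p) * (L + 5)"
        using p L by (simp add: content_Pair)
      finally show ?thesis by (simp add: p_def q_def diff_divide_distrib [symmetric])
    qed
    have scaled: "((\<lambda>x. of_real (h 0 x) * ?l x) has_integral
        (\<alpha> 0 0 * of_real G * of_real (ln z) + (\<Sum>k\<le>m. \<alpha> k 0 * of_real (F k) * of_real z ^ k)) / of_real z) {p..q}"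
    proof -
      have G: "(g 0 has_integral G) {1..2}"
        unfolding G_def by (intro integrable_integral integrable_continuous_real tower_continuous_on g(1))
      have F: "((\<lambda>u. g 0 u * leading_part k u) has_integral F k) {1..2}" for k
        unfolding F_def by (intro integrable_integral integrable_continuous_real lead_cont)
      have "((\<lambda>u. g 0 u * leading_part k (u / z)) has_integral (F k * z ^ k + (if k = 0 then G * ln z else 0))) {1..2}" for k
      proof -
        have "((\<lambda>u. g 0 u * leading_part k u * z ^ k + g 0 u * (if k = 0 then ln z else 0)) has_integral
            (F k * z ^ k + G * (if k = 0 then ln z else 0))) {1..2}"
          by (intro has_integral_add has_integral_mult_left F G)
        then have "((\<lambda>u. g 0 u * leading_part k (u / z)) has_integral (F k * z ^ k + G * (if k = 0 then ln z else 0))) {1..2}"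
          by (rule has_integral_eq [rotated]) (use z in \<open>auto simp: leading_part_scale algebra_simps\<close>)
        then show ?thesis by (rule has_integral_eq_rhs) simp
      qed
      then have "((\<lambda>u. \<Sum>k\<le>m. \<alpha> k 0 * of_real (g 0 u * leading_part k (u / z))) has_integral
          (\<Sum>k\<le>m. \<alpha> k 0 * of_real (F k * z ^ k + (if k = 0 then G * ln z else 0)))) {1..2}"
        by (intro has_integral_sum has_integral_mult_right has_integral_of_real) auto
      moreover have "(\<Sum>k\<le>m. \<alpha> k 0 * of_real (F k * z ^ k + (if k = 0 then G * ln z else 0)))
          = \<alpha> 0 0 * of_real G * of_real (ln z) + (\<Sum>k\<le>m. \<alpha> k 0 * of_real (F k) * of_real z ^ k)" (is "_ = ?R")
      proof -
        have "(\<Sum>k\<le>m. \<alpha> k 0 * of_real (F k * z ^ k + (if k = 0 then G * ln z else 0)))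
           = (\<Sum>k\<le>m. \<alpha> k 0 * of_real (F k) * of_real z ^ k + (if k = 0 then \<alpha> 0 0 * of_real G * of_real (ln z) else 0))"
          by (intro sum.cong) (auto simp: algebra_simps)
        then show ?thesis by (simp add: sum.distrib)
      qed
      ultimately have "((\<lambda>u. \<Sum>k\<le>m. \<alpha> k 0 * of_real (g 0 u * leading_part k (u / z))) has_integral ?R) (cbox 1 2)" by simp
      from has_integral_affinity' [OF this, of z 0] z
      have "((\<lambda>x. \<Sum>k\<le>m. \<alpha> k 0 * of_real (g 0 (z * x) * leading_part k (z * x / z))) has_integral ?R /\<^sub>R z) {p..q}"
        by (simp add: p_def q_def divide_inverse mult.commute)
      then have "((\<lambda>x. of_real (h 0 x) * ?l x) has_integral ?R /\<^sub>R z) {p..q}"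
        by (rule has_integral_eq [rotated]) (use z in \<open>simp add: h_def sum_distrib_left mult_ac\<close>)
      then show ?thesis by (rule has_integral_eq_rhs) (simp add: scaleR_conv_of_real divide_inverse mult.commute)
    qed
    let ?R = "\<alpha> 0 0 * of_real G * of_real (ln z) + (\<Sum>k\<le>m. \<alpha> k 0 * of_real (F k) * of_real z ^ k)"
    have "((\<lambda>x. of_real (h 0 x) * H x - of_real (h 0 x) * ?l x) has_integral (?u - ?R / of_real z)) {p..q}"
      unfolding u by (intro has_integral_diff integrable_integral hH scaled)
    then have "cmod (?u - ?R / of_real z) \<le> E * measure lborel (cbox p q)"
      unfolding box_real(2) [symmetric]
    proof (rule has_integral_bound [rotated])
      show "0 \<le> E" by (rule order_trans [OF norm_ge_zero H [of 1]]) simp_all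
      fix x assume x: "x \<in> cbox p q"
      have "cmod (of_real (h 0 x) * H x - of_real (h 0 x) * ?l x) = \<bar>h 0 x\<bar> * cmod (H x - ?l x)"
        by (simp add: norm_mult flip: right_diff_distrib)
      also have "\<dots> \<le> 1 * E"
        using x p q h_le [of x] by (intro mult_mono H) auto
      finally show "cmod (of_real (h 0 x) * H x - of_real (h 0 x) * ?l x) \<le> E" by simp
    qed
    also have "\<dots> = E / z" using p by (simp add: p_def q_def diff_divide_distrib [symmetric])
    finally have "cmod (?R / of_real z) \<le> (L + 5) / z + E / z"
      using u_le norm_triangle_sub [of "?R / of_real z" ?u] by (simp add: norm_minus_commute)
    then show ?thesis using z by (simp add: norm_divide field_simps)
  qed
  then have "\<alpha> 0 0 * of_real G = 0" by (rule log_dominated_by_polynomial)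
  moreover have "G \<noteq> 0"
  proof
    assume "G = 0"
    then have "\<forall>x\<in>{1..2}. g 0 x = 0"
      unfolding G_def by (subst (asm) integral_eq_0_iff) (auto simp: g(2) tower_continuous_on [OF g(1)])
    moreover have "g 0 (3/2) = 1" by (rule g(4)) auto
    ultimately show False by force
  qed
  ultimately show ?thesis using charge by simp
qed

theorem proposition6p1:
  fixes L :: real and E1 E2 :: "(real \<times> real) set"
  assumes "L > 0"
    and "E1 = {(x, 0) | x. 0 \<le> x \<and> x \<le> L}"
    and "E2 = {(0, t) | t. 0 \<le> t \<and> t \<le> L}"
  shows "gamma_Theta_half E1 > 0 \<and> gamma_Theta_half E2 = 0"
proof
  have "E1 = {0..L} \<times> {0}" using assms(2) by auto
  then show "gamma_Theta_half E1 > 0" using gamma_horizontal_segment_pos [OF assms(1)] by simp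
  have E2: "E2 = {0} \<times> {0..L}" using assms(3) by auto
  have "gamma_Theta_half E2 \<le> 0"
    unfolding gamma_Theta_half_def
    by (rule SUP_least) (auto simp: E2 vertical_segment_no_charge [OF _ assms(1)])
  then show "gamma_Theta_half E2 = 0" by simp
qed

end
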